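(* Let $C=\{(0,0),(0,1),(0,2),(0,3)\}$ and define the following sixteen subsets of $\{1,2,3\}\times\{1,2,3\}$: $S_1=\{(1,1),(1,2),(1,3),(2,2),(3,2)\}$, $S_2=\{(1,2),(2,2),(3,1),(3,2),(3,3)\}$, $S_3=\{(1,1),(2,1),(2,2),(2,3),(3,1)\}$, $S_4=\{(1,3),(2,1),(2,2),(2,3),(3,3)\}$, $S_5=\{(1,1),(1,2),(2,2),(3,1),(3,2)\}$, $S_6=\{(1,2),(1,3),(2,2),(3,2),(3,3)\}$, $S_7=\{(1,1),(1,3),(2,1),(2,2),(2,3)\}$, $S_8=\{(2,1),(2,2),(2,3),(3,1),(3,3)\}$, $S_9=\{(1,1),(1,2),(3,1),(3,2)\}$, $S_{10}=\{(1,2),(1,3),(3,2),(3,3)\}$, $S_{11}=\{(1,1),(1,3),(2,1),(2,3)\}$, $S_{12}=\{(2,1),(2,3),(3,1),(3,3)\}$, $S_{13}=\{(1,1),(1,2),(1,3),(3,2)\}$, $S_{14}=\{(1,2),(3,1),(3,2),(3,3)\}$, $S_{15}=\{(1,1),(2,1),(2,3),(3,1)\}$, $S_{16}=\{(1,3),(2,1),(2,3),(3,3)\}$. For $1\le j\le 16$ let $X_j=C\cup S_j$ and $Y_j=\{(y,x):(x,y)\in X_j\}$. Then for every $j\in\{1,\dots,16\}$, $(123,X_j)\sim_{jd}(132,X_j)$ and $(123,Y_j)\sim_{jd}(132,Y_j)$. Moreover, for each of the four blocks $J=\{1,2,3,4\},\{5,6,7,8\},\{9,10,11,12\},\{13,14,15,16\}$,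 the four pairs $\{(123,X_j),(132,X_j)\}$, $j\in J$, have the same joint distribution, and the four pairs $\{(123,Y_j),(132,Y_j)\}$, $j\in J$, have the same joint distribution.
   Context: $S_n$ is the set of permutations $\pi=\pi_1\cdots\pi_n$ of $\{1,\dots,n\}$. A mesh pattern of length $k$ is a pair $(\tau,R)$ with $\tau\in S_k$ and $R\subseteq\{0,\dots,k\}\times\{0,\dots,k\}$ (the set of shaded boxes; box $(a,b)$ is the unit square with lower-left corner $(a,b)$). An occurrence of $(\tau,R)$ in $\pi\in S_n$ is a subsequence $\pi_{i_1}\cdots\pi_{i_k}$, $i_1<\dots<i_k$, order-isomorphic to $\tau$, such that, with $i_0=0$, $i_{k+1}=n+1$, with $v_1<\dots<v_k$ the values $\pi_{i_1},\dots,\pi_{i_k}$ in increasing order, and $v_0=0$, $v_{k+1}=n+1$, for each $(a,b)\in R$ there is no index $m$ with $i_a<m<i_{a+1}$ and $v_b<\pi_m<v_{b+1}$. Two mesh patterns $q_1,q_2$ are jointly equidistributed, written $q_1\sim_{jd}q_2$, if for all nonnegative integers $n,k,\ell$ the number of $\pi\in S_n$ with exactly $k$ occurrences of $q_1$ and $\ell$ occurrences of $q_2$ equals the number of $\pi\in S_n$ with exactly $\ell$ occurrences of $q_1$ and $k$ occurrences of $q_2$. The joint distribution of a pair $\{q_1,q_2\}$ (with $q_1$ having underlying permutation $123$ and $q_2$ having underlying permutation $132$) is the family of numbers $T_{n,k,\ell}$ of $\pi\in S_n$ with exactly $k$ occurrences of $q_1$ and $\ell$ occurrences of $q_2$; two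 pairs have the same joint distribution if these numbers agree for all $n,k,\ell$. *)

theory Defs
  imports "HOL-Combinatorics.Multiset_Permutations"
begin

text \<open>Permutations are lists in one-line notation: the permutations of size \<open>n\<close> are the
  elements of \<^term>\<open>permutations_of_set {1..n::nat}\<close>. Positions are counted from 1.\<close>

definition entry :: "nat list \<Rightarrow> nat \<Rightarrow> nat" where
  "entry \<pi> m = \<pi> ! (m - 1)"

type_synonym mesh_pattern = "nat list \<times> (nat \<times> nat) set"

definition is_mesh_pattern :: "mesh_pattern \<Rightarrow> bool" where
  "is_mesh_pattern q \<longleftrightarrow>
     (let \<tau> = fst q; R = snd q; k = length \<tau>
      in \<tau> \<in> permutations_of_set {1..k} \<and> R \<subseteq> {0..k} \<times> {0..k})"

definition order_isomorphic :: "nat list \<Rightarrow> nat list \<Rightarrow> bool" where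
  "order_isomorphic xs ys \<longleftrightarrow>
     length xs = length ys \<and>
     (\<forall>a < length xs. \<forall>b < length xs. xs ! a < xs ! b \<longleftrightarrow> ys ! a < ys ! b)"

text \<open>An occurrence is given by its list of positions \<open>is = [i\<^sub>1, \<dots>, i\<^sub>k]\<close>.
  The lists \<open>I\<close> and \<open>V\<close> carry the sentinels 0 and \<open>n + 1\<close>, so that \<open>I ! a\<close> is \<open>i\<^sub>a\<close> and
  \<open>V ! b\<close> is \<open>v\<^sub>b\<close> for \<open>a, b \<in> {0..k + 1}\<close>.\<close>

definition mesh_occurrence :: "mesh_pattern \<Rightarrow> nat list \<Rightarrow> nat list \<Rightarrow> bool" where
  "mesh_occurrence q \<pi> is \<longleftrightarrow>
     (let \<tau> = fst q; R = snd q; n = length \<pi>;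
          I = 0 # is @ [n + 1];
          V = 0 # sort (map (entry \<pi>) is) @ [n + 1]
      in sorted_wrt (<) is \<and> set is \<subseteq> {1..n} \<and>
         order_isomorphic (map (entry \<pi>) is) \<tau> \<and>
         (\<forall>(a, b) \<in> R. \<not> (\<exists>m. I ! a < m \<and> m < I ! (a + 1) \<and>
                              V ! b < entry \<pi> m \<and> entry \<pi> m < V ! (b + 1))))"

definition occurrences :: "mesh_pattern \<Rightarrow> nat list \<Rightarrow> nat" where
  "occurrences q \<pi> = card {is. mesh_occurrence q \<pi> is}"

definition joint_distribution ::
    "mesh_pattern \<Rightarrow> mesh_pattern \<Rightarrow> nat \<Rightarrow> nat \<Rightarrow> nat \<Rightarrow> nat" where
  "joint_distribution q1 q2 n k l =
     card {\<pi> \<in> permutations_of_set {1..n}. occurrences q1 \<pi> = k \<and> occurrences q2 \<pi> = l}"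

definition jointly_equidistributed :: "mesh_pattern \<Rightarrow> mesh_pattern \<Rightarrow> bool"
    (infix "\<sim>jd" 50) where
  "q1 \<sim>jd q2 \<longleftrightarrow>
     (\<forall>n k l. joint_distribution q1 q2 n k l = joint_distribution q1 q2 n l k)"

definition same_joint_distribution ::
    "mesh_pattern \<times> mesh_pattern \<Rightarrow> mesh_pattern \<times> mesh_pattern \<Rightarrow> bool" where
  "same_joint_distribution p p' \<longleftrightarrow>
     (\<forall>n k l. joint_distribution (fst p) (snd p) n k l =
              joint_distribution (fst p') (snd p') n k l)"

definition shadeC :: "(nat \<times> nat) set" where
  "shadeC = {(0,0), (0,1), (0,2), (0,3)}"

definition shadings :: "(nat \<times> nat) set list" where
  "shadings =
    [{(1,1), (1,2), (1,3), (2,2), (3,2)},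
     {(1,2), (2,2), (3,1), (3,2), (3,3)},
     {(1,1), (2,1), (2,2), (2,3), (3,1)},
     {(1,3), (2,1), (2,2), (2,3), (3,3)},
     {(1,1), (1,2), (2,2), (3,1), (3,2)},
     {(1,2), (1,3), (2,2), (3,2), (3,3)},
     {(1,1), (1,3), (2,1), (2,2), (2,3)},
     {(2,1), (2,2), (2,3), (3,1), (3,3)},
     {(1,1), (1,2), (3,1), (3,2)},
     {(1,2), (1,3), (3,2), (3,3)},
     {(1,1), (1,3), (2,1), (2,3)},
     {(2,1), (2,3), (3,1), (3,3)},
     {(1,1), (1,2), (1,3), (3,2)},
     {(1,2), (3,1), (3,2), (3,3)},
     {(1,1), (2,1), (2,3), (3,1)},
     {(1,3), (2,1), (2,3), (3,3)}]"

text \<open>\<open>shadeS j\<close> is meaningful for \<open>1 \<le> j \<le> 16\<close> only.\<close>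

definition shadeS :: "nat \<Rightarrow> (nat \<times> nat) set" where
  "shadeS j = shadings ! (j - 1)"

definition shadeX :: "nat \<Rightarrow> (nat \<times> nat) set" where
  "shadeX j = shadeC \<union> shadeS j"

definition shadeY :: "nat \<Rightarrow> (nat \<times> nat) set" where
  "shadeY j = {(y, x) |x y. (x, y) \<in> shadeX j}"

lemma is_mesh_pattern_shadings:
  assumes "j \<in> {1..16}" and "\<tau> \<in> {[1,2,3], [1,3,2]}" and "R \<in> {shadeX j, shadeY j}"
  shows "is_mesh_pattern (\<tau>, R)"
proof -
  have "\<forall>S \<in> set shadings. S \<subseteq> {0..3} \<times> {0..3}"
    unfolding shadings_def by simp
  moreover have "length shadings = 16"
    unfolding shadings_def by simp
  ultimately have "shadeS j \<subseteq> {0..3} \<times> {0..3}"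
    using assms(1) unfolding shadeS_def by auto
  then have X: "shadeX j \<subseteq> {0..3} \<times> {0..3}"
    unfolding shadeX_def shadeC_def by auto
  then have Y: "shadeY j \<subseteq> {0..3} \<times> {0..3}"
    unfolding shadeY_def by auto
  have *: "{1..3} = {1, 2, 3::nat}" by auto
  have "\<tau> \<in> permutations_of_set {1..3}"
    unfolding * permutations_of_set_def using assms(2) by auto
  moreover have "length \<tau> = 3" using assms(2) by auto
  ultimately show ?thesis
    using X Y assms(3) unfolding is_mesh_pattern_def by auto
qed

end

theory Submission
  imports Defs
begin


text \<open>Since column 0 is shaded, an occurrence of \<open>(123, X\<^sub>j)\<close> or \<open>(132, X\<^sub>j)\<close> in \<open>\<pi>\<close>
  starts with \<open>\<pi>\<^sub>1\<close>, and since row 0 is otherwise unshaded, the rest of it is an occurrence of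
  \<open>(12, S)\<close> or \<open>(21, S)\<close> in the standardization \<open>\<sigma>\<close> of the letters exceeding \<open>\<pi>\<^sub>1\<close>, where
  \<open>S\<close> is \<open>S\<^sub>j\<close> shifted by \<open>(-1, -1)\<close>. For fixed \<open>\<pi>\<^sub>1\<close> all \<open>\<sigma>\<close> arise equally often, so it
  suffices to study the pair \<open>(12, S), (21, S)\<close>. Reversal mirrors \<open>S\<close> and exchanges \<open>12\<close> with
  \<open>21\<close>; inversion transposes \<open>S\<close> and fixes both. Each of the four blocks is a single orbit
  \<open>{S, S\<^sup>T, mirror S, (mirror S)\<^sup>T}\<close> in which \<open>S\<^sup>T\<close> is its own mirror image; hence the
  symmetry of the joint distribution. Inverting the whole permutation turns \<open>X\<^sub>j\<close> into \<open>Y\<^sub>j\<close>.\<close>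

section \<open>Occurrences as sets of points\<close>

text \<open>Point sets replace lists of positions because inversion and reversal then act as images
  under coordinate maps.\<close>

definition points :: "nat list \<Rightarrow> (nat \<times> nat) set" where
  "points \<pi> = (\<lambda>i. (i, entry \<pi> i)) ` {1..length \<pi>}"

definition box :: "(nat \<times> nat) set \<Rightarrow> nat \<times> nat \<Rightarrow> nat \<times> nat" where
  "box T r = (card {p \<in> T. fst p < fst r}, card {p \<in> T. snd p < snd r})"

definition profile :: "nat list \<Rightarrow> (nat \<times> nat) set" where
  "profile \<tau> = (\<lambda>i. (i, \<tau> ! i - 1)) ` {..<length \<tau>}"

text \<open>The points of \<open>T\<close> itself are mapped by \<open>box T\<close> to their pairs of ranks, counted from 0.
  So \<open>box T ` T = profile \<tau>\<close> says that \<open>T\<close> is order-isomorphic to \<open>\<tau>\<close>.\<close>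

definition occ_sets :: "mesh_pattern \<Rightarrow> (nat \<times> nat) set \<Rightarrow> (nat \<times> nat) set set" where
  "occ_sets q P = {T. T \<subseteq> P \<and> box T ` T = profile (fst q) \<and> box T ` (P - T) \<inter> snd q = {}}"

text \<open>Without common coordinates, the strict inequalities in \<^const>\<open>box\<close> agree with the open boxes
  of the mesh.\<close>

definition general_position :: "(nat \<times> nat) set \<Rightarrow> bool" where
  "general_position P \<longleftrightarrow> finite P \<and> inj_on fst P \<and> inj_on snd P"

section \<open>Ranks and boxes in general position\<close>

lemma rank_less_iff:
  fixes f :: "'a \<Rightarrow> nat"
  assumes "finite T" "p \<in> T" "q \<in> T"
  shows "card {t \<in> T. f t < f p} < card {t \<in> T. f t < f q} \<longleftrightarrow> f p < f q"
proof (cases "f p < f q")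
  case True
  \<comment> \<open>The inclusion is strict because \<open>p\<close> itself belongs to the
    right-hand set only.\<close>
  then have "{t \<in> T. f t < f p} \<subset> {t \<in> T. f t < f q}"
    using assms by force
  then show ?thesis
    using True assms(1) by (simp add: psubset_card_mono)
next
  case False
  then have "{t \<in> T. f t < f q} \<subseteq> {t \<in> T. f t < f p}" by auto
  then show ?thesis
    using False assms(1) by (simp add: card_mono leD)
qed

lemma rank_inj_on:
  fixes f :: "'a \<Rightarrow> nat"
  assumes "finite T" "inj_on f T"
  shows "inj_on (\<lambda>p. card {t \<in> T. f t < f p}) T"
proof (rule inj_onI)
  fix p q assume pq: "p \<in> T" "q \<in> T" and eq: "card {t \<in> T. f t < f p} = card {t \<in> T. f t < f q}"
  then have "\<not> f p < f q" "\<not> f q < f p"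
    using rank_less_iff[OF assms(1) pq, of f] rank_less_iff[OF assms(1) pq(2,1), of f] by auto
  then show "p = q"
    using assms(2) pq by (meson inj_onD linorder_neqE_nat)
qed

lemma general_position_subset:
  "general_position P \<Longrightarrow> T \<subseteq> P \<Longrightarrow> general_position T"
  unfolding general_position_def by (meson finite_subset inj_on_subset)

text \<open>The first coordinate of the box alone already separates the points.\<close>

lemma inj_on_box:
  assumes "general_position T"
  shows "inj_on (box T) T"
  using rank_inj_on[of T fst] assms
  unfolding general_position_def box_def inj_on_def by auto

lemma card_profile: "card (profile \<tau>) = length \<tau>"
  unfolding profile_def by (subst card_image) (auto intro: inj_onI)

text \<open>\<open>box T\<close> is injective on \<open>T\<close>, so \<open>T\<close> has as many
  points as the profile it is mapped onto.\<close>

lemma card_occurrence: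
  assumes "general_position P" "T \<subseteq> P" "box T ` T = profile \<tau>"
  shows "card T = length \<tau>"
  using card_image[OF inj_on_box[OF general_position_subset[OF assms(1,2)]]] assms(3)
  by (simp add: card_profile)

text \<open>This turns the open intervals of the mesh into the counts used by \<open>box\<close>.
  The induction generalizes the lower sentinel, so that the first letter can take its place.\<close>

lemma between_sentinels_iff:
  fixes xs :: "nat list"
  assumes "sorted_wrt (<) (l # xs @ [u])" "l < m" "m < u" "a \<le> length xs"
  shows "(l # xs @ [u]) ! a < m \<and> m < (l # xs @ [u]) ! (a + 1) \<longleftrightarrow>
         m \<notin> set xs \<and> card {x \<in> set xs. x < m} = a"
  using assms
proof (induction xs arbitrary: l a)
  case Nil
  then show ?case by simp
next
  case (Cons x xs)
  show ?case
  proof (cases a)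
    case 0
    have "card {y \<in> set (x # xs). y < m} = 0 \<longleftrightarrow> (\<forall>y \<in> set (x # xs). m \<le> y)"
      by (simp add: card_eq_0_iff) force
    then show ?thesis
      using Cons.prems 0 by auto
  next
    case (Suc b)
    show ?thesis
    proof (cases "x < m")
      case True
      have "x \<notin> set xs" using Cons.prems by auto
      moreover have "{y \<in> set (x # xs). y < m} = insert x {y \<in> set xs. y < m}"
        using True by auto
      ultimately have "card {y \<in> set (x # xs). y < m} = Suc (card {y \<in> set xs. y < m})"
        by simp
      \<comment> \<open>With \<open>x\<close> as the new lower sentinel, the interval index and the
        rank both drop by one.\<close>
      then show ?thesis
        using Cons.IH[of x b] Cons.prems True Suc by auto
    next
      case False
      \<comment> \<open>Interval \<open>Suc b\<close> starts at \<open>x\<close> or later, hence not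
        below \<open>m\<close>, while no letter is smaller than \<open>m\<close>: both sides are
        false.\<close>
      have "x \<le> (x # xs @ [u]) ! b"
        using Cons.prems Suc by (cases b) (auto simp: nth_append less_imp_le)
        then have "\<not> (x # xs @ [u]) ! b < m" using False by simp
      moreover have "{y \<in> set (x # xs). y < m} = {}"
        using False Cons.prems(1) by force
      then have "card {y \<in> set (x # xs). y < m} \<noteq> a" using Suc by (metis card.empty nat.distinct(1))
      ultimately show ?thesis
        using Suc by simp
    qed
  qed
qed

section \<open>From position lists to point sets\<close>

lemma permutation_facts:
  assumes "\<pi> \<in> permutations_of_set {1..n}"
  shows length_permutation: "length \<pi> = n"
    and bij_betw_entry: "bij_betw (entry \<pi>) {1..n} {1..n}"
proof -
  show len: "length \<pi> = n"
    using length_finite_permutations_of_set[OF assms] by simp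
  have "set \<pi> = {1..n}" "distinct \<pi>"
    using assms permutations_of_setD by blast+
  then have "bij_betw (\<lambda>i. \<pi> ! i) {..<n} {1..n}"
    using bij_betw_nth len by blast
  moreover have "bij_betw (\<lambda>i. i - 1) {1..n} {..<n}"
    by (rule bij_betw_byWitness[where f' = Suc]) auto
  ultimately show "bij_betw (entry \<pi>) {1..n} {1..n}"
    using bij_betw_trans unfolding entry_def comp_def by fastforce
qed

lemma general_position_points:
  assumes "\<pi> \<in> permutations_of_set {1..n}"
  shows "general_position (points \<pi>)"
proof -
  have "inj_on (entry \<pi>) {1..length \<pi>}"
    using permutation_facts[OF assms] by (simp add: bij_betw_def)
  then show ?thesis
    unfolding general_position_def points_def by (auto simp: inj_on_def)
qed

text \<open>Two words are order-isomorphic exactly when letters in equal places have equal ranks,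
  and in a permutation of \<open>{1..k}\<close> the letter \<open>v\<close> has rank
  \<open>v - 1\<close>.\<close>

lemma order_isomorphic_iff_profile:
  assumes xs: "distinct xs" and \<tau>: "\<tau> \<in> permutations_of_set {1..k}"
  shows "order_isomorphic xs \<tau> \<longleftrightarrow>
         length xs = k \<and> (\<forall>i < k. card {x \<in> set xs. x < xs ! i} = \<tau> ! i - 1)"
proof -
  have len: "length \<tau> = k" and set: "set \<tau> = {1..k}" and dist: "distinct \<tau>"
    using \<tau> length_permutation permutations_of_setD by blast+
  have rank: "card {x \<in> set ys. x < y} = card {b. b < length ys \<and> ys ! b < y}"
    if "distinct ys" for ys :: "nat list" and y
  proof -
    have "{x \<in> set ys. x < y} = (!) ys ` {b. b < length ys \<and> ys ! b < y}"
      by (auto simp: in_set_conv_nth)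
    moreover have "inj_on ((!) ys) {b. b < length ys \<and> ys ! b < y}"
      using that by (auto simp: inj_on_def nth_eq_iff_index_eq)
    ultimately show ?thesis by (simp add: card_image)
  qed
  have rank_\<tau>: "card {x \<in> set \<tau>. x < \<tau> ! i} = \<tau> ! i - 1" if "i < k" for i
  proof -
    have "\<tau> ! i \<in> {1..k}" using that len set by (metis nth_mem)
    then have "{x \<in> set \<tau>. x < \<tau> ! i} = {1..<\<tau> ! i}" using set by auto
    then show ?thesis by simp
  qed
  show ?thesis
  proof
    assume oi: "order_isomorphic xs \<tau>"
    then have lx: "length xs = k" using len unfolding order_isomorphic_def by simp
    have "{b. b < length xs \<and> xs ! b < xs ! i} = {b. b < length \<tau> \<and> \<tau> ! b < \<tau> ! i}"
      if "i < k" for i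
      using oi that lx len unfolding order_isomorphic_def by auto
    then have "card {x \<in> set xs. x < xs ! i} = \<tau> ! i - 1" if "i < k" for i
      using rank[OF xs, of "xs ! i"] rank[OF dist, of "\<tau> ! i"] rank_\<tau> that by simp
    then show "length xs = k \<and> (\<forall>i < k. card {x \<in> set xs. x < xs ! i} = \<tau> ! i - 1)"
      using lx by blast
  next
    assume r: "length xs = k \<and> (\<forall>i < k. card {x \<in> set xs. x < xs ! i} = \<tau> ! i - 1)"
    have "xs ! a < xs ! b \<longleftrightarrow> \<tau> ! a < \<tau> ! b" if "a < k" "b < k" for a b
    proof -
      have "xs ! a \<in> set xs" "xs ! b \<in> set xs" "\<tau> ! a \<in> set \<tau>" "\<tau> ! b \<in> set \<tau>"
        using that r len by simp_all
      then have "xs ! a < xs ! b \<longleftrightarrow> card {x \<in> set xs. x < xs ! a} < card {x \<in> set xs. x < xs ! b}"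
        and "\<tau> ! a < \<tau> ! b \<longleftrightarrow> card {x \<in> set \<tau>. x < \<tau> ! a} < card {x \<in> set \<tau>. x < \<tau> ! b}"
        using rank_less_iff[of "set xs" "xs ! a" "xs ! b" "\<lambda>x. x"]
          rank_less_iff[of "set \<tau>" "\<tau> ! a" "\<tau> ! b" "\<lambda>x. x"] by blast+
      moreover have "card {x \<in> set xs. x < xs ! a} = card {x \<in> set \<tau>. x < \<tau> ! a}"
        "card {x \<in> set xs. x < xs ! b} = card {x \<in> set \<tau>. x < \<tau> ! b}"
        using r that rank_\<tau> by metis+
      ultimately show ?thesis by metis
    qed
    then show "order_isomorphic xs \<tau>"
      using r len unfolding order_isomorphic_def by simp
  qed
qed


text \<open>Ranks inside \<open>T\<close> express the order isomorphism, and the boxes of the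
  remaining points express the shading, since positions and values can be counted
  separately.\<close>

lemma mesh_occurrence_iff:
  assumes \<pi>: "\<pi> \<in> permutations_of_set {1..n}" and q: "is_mesh_pattern q"
    and sorted: "sorted_wrt (<) is" and range: "set is \<subseteq> {1..n}"
  shows "mesh_occurrence q \<pi> is \<longleftrightarrow> (\<lambda>i. (i, entry \<pi> i)) ` set is \<in> occ_sets q (points \<pi>)"
proof -
  obtain \<tau> R where q_eq: "q = (\<tau>, R)" by force
  define k where "k = length \<tau>"
  have \<tau>: "\<tau> \<in> permutations_of_set {1..k}" and R: "R \<subseteq> {0..k} \<times> {0..k}"
    using q unfolding q_eq is_mesh_pattern_def k_def Let_def by simp_all
  have len: "length \<pi> = n" and inj: "inj_on (entry \<pi>) {1..n}"
    and im: "entry \<pi> ` {1..n} = {1..n}"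
    using permutation_facts[OF \<pi>] by (auto simp: bij_betw_def)
  define g where "g = (\<lambda>i. (i, entry \<pi> i))"
  define T where "T = g ` set is"
  define vs where "vs = map (entry \<pi>) is"
  have dist: "distinct is" using sorted strict_sorted_iff by blast
  have dist_vs: "distinct vs" unfolding vs_def
    using dist inj range by (simp add: distinct_map inj_on_subset)
  have box: "box T (g m) = (card {i \<in> set is. i < m}, card {v \<in> set vs. v < entry \<pi> m})" for m
  proof -
    have "{p \<in> T. fst p < m} = g ` {i \<in> set is. i < m}"
      unfolding T_def g_def by auto
    then have 1: "card {p \<in> T. fst p < m} = card {i \<in> set is. i < m}"
      by (simp add: card_image g_def inj_on_def)
    have "{v \<in> set vs. v < entry \<pi> m} = snd ` {p \<in> T. snd p < entry \<pi> m}"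
      unfolding T_def g_def vs_def by force
    moreover have "inj_on snd T"
      using inj range unfolding T_def g_def inj_on_def by auto
    then have "inj_on snd {p \<in> T. snd p < entry \<pi> m}"
      by (rule inj_on_subset) auto
    ultimately have 2: "card {v \<in> set vs. v < entry \<pi> m} = card {p \<in> T. snd p < entry \<pi> m}"
      by (simp add: card_image)
    show ?thesis using 1 2 by (simp add: box_def g_def)
  qed
  \<comment> \<open>The positions increase, so the entry with list index \<open>b\<close> has
    exactly \<open>b\<close> smaller ones; indices start at 0.\<close>
  have rank_is: "card {i \<in> set is. i < is ! b} = b" if "b < length is" for b
  proof -
    have less: "is ! c < is ! b \<longleftrightarrow> c < b" if "c < length is" for c
      using sorted_wrt_nth_less[OF sorted, of c b] sorted_wrt_nth_less[OF sorted, of b c]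
        that \<open>b < length is\<close> by (cases c b rule: linorder_cases) auto
    have "{i \<in> set is. i < is ! b} = (!) is ` {c. c < length is \<and> is ! c < is ! b}"
      by (auto simp: in_set_conv_nth)
    also have "{c. c < length is \<and> is ! c < is ! b} = {..<b}"
      using less that by auto
    finally have "{i \<in> set is. i < is ! b} = (!) is ` {..<b}" .
    moreover have "inj_on ((!) is) {..<b}"
      using dist that by (auto simp: inj_on_def nth_eq_iff_index_eq)
    ultimately show ?thesis by (simp add: card_image)
  qed
  have prof: "order_isomorphic vs \<tau> \<longleftrightarrow> box T ` T = profile \<tau>"
  proof -
    have boxT: "box T ` T = (\<lambda>b. (b, card {v \<in> set vs. v < vs ! b})) ` {..<length is}"
    proof -
      have "set is = (!) is ` {..<length is}"
        by (auto simp: in_set_conv_nth)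
      then have "T = (\<lambda>b. g (is ! b)) ` {..<length is}"
        unfolding T_def by (simp add: image_image)
      then have "box T ` T = (\<lambda>b. box T (g (is ! b))) ` {..<length is}"
        by (simp add: image_image)
      also have "\<dots> = (\<lambda>b. (b, card {v \<in> set vs. v < vs ! b})) ` {..<length is}"
        by (rule image_cong) (simp_all add: box rank_is vs_def)
      finally show ?thesis .
    qed
    \<comment> \<open>Both the profile and the boxes of \<open>T\<close> are graphs of functions on
      initial segments, and such a graph determines its length and its values.\<close>
    have graph: "(\<lambda>b. (b, f b)) ` {..<l} = (\<lambda>b. (b, f' b)) ` {..<l'} \<longleftrightarrow>
      l = l' \<and> (\<forall>b < l. f b = f' b)" for f f' :: "nat \<Rightarrow> nat" and l l'
    proof
      assume eq: "(\<lambda>b. (b, f b)) ` {..<l} = (\<lambda>b. (b, f' b)) ` {..<l'}"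
      then have "fst ` (\<lambda>b. (b, f b)) ` {..<l} = fst ` (\<lambda>b. (b, f' b)) ` {..<l'}" by simp
      then have "l = l'" by (simp add: image_image)
      then show "l = l' \<and> (\<forall>b < l. f b = f' b)" using eq by auto
    qed (auto intro: image_cong)
    show ?thesis
      unfolding boxT profile_def graph order_isomorphic_iff_profile[OF dist_vs \<tau>]
      by (auto simp: k_def vs_def)
  qed
  \<comment> \<open>\<open>hit a b\<close> is the condition that a shaded box \<open>(a, b)\<close>
    must avoid, in the wording of \<open>mesh_occurrence\<close>.\<close>
  define hit where "hit a b \<longleftrightarrow>
      (\<exists>m. (0 # is @ [n + 1]) ! a < m \<and> m < (0 # is @ [n + 1]) ! (a + 1) \<and>
        (0 # sort vs @ [n + 1]) ! b < entry \<pi> m \<and> entry \<pi> m < (0 # sort vs @ [n + 1]) ! (b + 1))" for a b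
  have hit: "hit a b \<longleftrightarrow> (a, b) \<in> box T ` (points \<pi> - T)"
    if ab: "a \<le> length is" "b \<le> length is" for a b
  proof -
    let ?I = "0 # is @ [n + 1]" and ?V = "0 # sort vs @ [n + 1]"
    have vs_range: "set vs \<subseteq> {1..n}" unfolding vs_def using range im by auto
    have I: "sorted_wrt (<) ?I"
      using sorted range by (fastforce simp: sorted_wrt_append)
    have "sorted_wrt (<) (sort vs)"
      using dist_vs by (simp add: strict_sorted_iff)
    then have V: "sorted_wrt (<) ?V"
      using vs_range by (fastforce simp: sorted_wrt_append)
    have row: "?V ! b < v \<and> v < ?V ! (b + 1) \<longleftrightarrow> v \<notin> set vs \<and> card {x \<in> set vs. x < v} = b"
      if "v \<in> {1..n}" for v
      using between_sentinels_iff[OF V, of v b] that ab by (simp add: vs_def)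
    have col: "?I ! a < m \<and> m < ?I ! (a + 1) \<longleftrightarrow> m \<notin> set is \<and> card {x \<in> set is. x < m} = a"
      if "m \<in> {1..n}" for m
      using between_sentinels_iff[OF I, of m a] that ab by simp
    \<comment> \<open>In \<open>mesh_occurrence\<close> the index \<open>m\<close> ranges over all
      naturals; the sentinels 0 and \<open>n + 1\<close> confine it to genuine positions.\<close>
    have bounded: "m \<in> {1..n}" if "?I ! a < m" "m < ?I ! (a + 1)" for m
    proof -
      have "?I ! (a + 1) \<in> set (is @ [n + 1])" using ab by (simp add: nth_append)
      then have "?I ! (a + 1) \<le> n + 1" using range by auto
      then show ?thesis using that by auto
    qed
    \<comment> \<open>As the entries are distinct, a point avoids the chosen values exactly when it
      avoids the chosen positions.\<close>
    have notin: "entry \<pi> m \<notin> set vs \<longleftrightarrow> m \<notin> set is" if "m \<in> {1..n}" for m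
      unfolding vs_def using inj_on_image_mem_iff[OF inj that range] by simp
    have "hit a b \<longleftrightarrow> (\<exists>m \<in> {1..n}. (?I ! a < m \<and> m < ?I ! (a + 1)) \<and>
            (?V ! b < entry \<pi> m \<and> entry \<pi> m < ?V ! (b + 1)))"
      unfolding hit_def using bounded by blast
    also have "\<dots> \<longleftrightarrow> (\<exists>m \<in> {1..n}. m \<notin> set is \<and> box T (g m) = (a, b))"
    proof (rule bex_cong[OF refl])
      fix m assume m: "m \<in> {1..n}"
      then have "entry \<pi> m \<in> {1..n}" using im by blast
      then show "(?I ! a < m \<and> m < ?I ! (a + 1)) \<and>
            (?V ! b < entry \<pi> m \<and> entry \<pi> m < ?V ! (b + 1)) \<longleftrightarrow>
            m \<notin> set is \<and> box T (g m) = (a, b)"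
        unfolding row[OF \<open>entry \<pi> m \<in> {1..n}\<close>] col[OF m] notin[OF m] box by auto
    qed
    also have "\<dots> \<longleftrightarrow> (a, b) \<in> box T ` (points \<pi> - T)"
    proof -
      have "points \<pi> - T = g ` {m \<in> {1..n}. m \<notin> set is}"
        unfolding points_def T_def len g_def by auto
      then show ?thesis by (simp only: image_image image_iff) fastforce
    qed
    finally show ?thesis .
  qed
  have "T \<subseteq> points \<pi>"
    unfolding T_def points_def len g_def using range by auto
  \<comment> \<open>The description of \<open>hit\<close> covers indices up to
    \<open>length is\<close> only; the shading stays in that range once this length is
    \<open>k\<close>.\<close>
  moreover have "(\<forall>(a, b) \<in> R. \<not> hit a b) \<longleftrightarrow> box T ` (points \<pi> - T) \<inter> R = {}"
    if "length is = k"
  proof -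
    have "\<not> hit (fst r) (snd r) \<longleftrightarrow> r \<notin> box T ` (points \<pi> - T)" if "r \<in> R" for r
    proof -
      have "r \<in> {0..length is} \<times> {0..length is}"
        using R that \<open>length is = k\<close> by blast
      then have "fst r \<le> length is" "snd r \<le> length is" by auto
      then show ?thesis using hit[of "fst r" "snd r"] by simp
    qed
    then show ?thesis by (auto simp: case_prod_unfold)
  qed
  moreover have "length is = k" if "order_isomorphic vs \<tau>"
    using that unfolding order_isomorphic_def vs_def k_def by simp
  moreover have "mesh_occurrence q \<pi> is \<longleftrightarrow> order_isomorphic vs \<tau> \<and> (\<forall>(a, b) \<in> R. \<not> hit a b)"
    unfolding mesh_occurrence_def q_eq Let_def len hit_def
    using sorted range by (simp only: fst_conv snd_conv vs_def simp_thms)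
  ultimately have "mesh_occurrence q \<pi> is \<longleftrightarrow> T \<in> occ_sets q (points \<pi>)"
    using prof unfolding occ_sets_def q_eq by auto
  then show ?thesis unfolding T_def g_def .
qed

text \<open>An increasing list of positions is recovered from its point set by sorting the first
  coordinates.\<close>

lemma occurrences_eq:
  assumes \<pi>: "\<pi> \<in> permutations_of_set {1..n}" and q: "is_mesh_pattern q"
  shows "occurrences q \<pi> = card (occ_sets q (points \<pi>))"
proof -
  let ?g = "\<lambda>i. (i, entry \<pi> i)"
  have len: "length \<pi> = n" using permutation_facts[OF \<pi>] by simp
  have "bij_betw (\<lambda>is. ?g ` set is) {is. mesh_occurrence q \<pi> is} (occ_sets q (points \<pi>))"
  proof (rule bij_betw_byWitness[where f' = "\<lambda>T. sorted_list_of_set (fst ` T)"])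
    have occ: "sorted_wrt (<) is \<and> set is \<subseteq> {1..n}" if "mesh_occurrence q \<pi> is" for "is"
      using that unfolding mesh_occurrence_def Let_def len by blast
    show "\<forall>is \<in> {is. mesh_occurrence q \<pi> is}. sorted_list_of_set (fst ` ?g ` set is) = is"
      using occ by (auto simp: image_image sorted_list_of_set.idem_if_sorted_distinct
          strict_sorted_iff)
    have fin: "finite T" and inv: "?g ` fst ` T = T" and range: "fst ` T \<subseteq> {1..n}"
      if "T \<in> occ_sets q (points \<pi>)" for T
    proof -
      have T: "T \<subseteq> ?g ` {1..n}"
        using that unfolding occ_sets_def points_def len by blast
      then show "finite T" by (rule finite_subset) simp
      show "?g ` fst ` T = T" "fst ` T \<subseteq> {1..n}" using T by force+
    qed
    then show "\<forall>T \<in> occ_sets q (points \<pi>). ?g ` set (sorted_list_of_set (fst ` T)) = T"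
      by simp
    show "(\<lambda>is. ?g ` set is) ` {is. mesh_occurrence q \<pi> is} \<subseteq> occ_sets q (points \<pi>)"
      using occ mesh_occurrence_iff[OF \<pi> q] by blast
    show "(\<lambda>T. sorted_list_of_set (fst ` T)) ` occ_sets q (points \<pi>) \<subseteq> {is. mesh_occurrence q \<pi> is}"
    proof safe
      fix T assume T: "T \<in> occ_sets q (points \<pi>)"
      show "mesh_occurrence q \<pi> (sorted_list_of_set (fst ` T))"
        using mesh_occurrence_iff[OF \<pi> q, of "sorted_list_of_set (fst ` T)"]
          fin[OF T] inv[OF T] range[OF T] T by simp
    qed
  qed
  then show ?thesis unfolding occurrences_def by (rule bij_betw_same_card)
qed


section \<open>Inverse and reversal\<close>

lemma permutations_of_set_atLeastAtMost_iff:
  "\<pi> \<in> permutations_of_set {1..n} \<longleftrightarrow> length \<pi> = n \<and> bij_betw (entry \<pi>) {1..n} {1..n}"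
proof
  assume "\<pi> \<in> permutations_of_set {1..n}"
  then show "length \<pi> = n \<and> bij_betw (entry \<pi>) {1..n} {1..n}"
    using permutation_facts by blast
next
  assume *: "length \<pi> = n \<and> bij_betw (entry \<pi>) {1..n} {1..n}"
  have "bij_betw Suc {..<n} {1..n}"
    by (rule bij_betw_byWitness[where f' = "\<lambda>i. i - 1"]) auto
  then have "bij_betw (entry \<pi> \<circ> Suc) {..<n} {1..n}"
    using * bij_betw_trans by blast
  moreover have "entry \<pi> \<circ> Suc = (!) \<pi>"
    by (simp add: fun_eq_iff entry_def)
  ultimately have "bij_betw ((!) \<pi>) {..<length \<pi>} {1..n}"
    using * by simp
  then have "distinct \<pi>" "set \<pi> = {1..n}"
    by (auto simp: bij_betw_def set_conv_nth distinct_conv_nth inj_on_def)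
  then show "\<pi> \<in> permutations_of_set {1..n}"
    by (simp add: permutations_of_setI)
qed

text \<open>Being an involution, \<open>h\<close> is its own inverse, so transporting the counts in
  one direction suffices for a bijection.\<close>

lemma joint_distribution_bij:
  assumes "\<And>\<pi>. \<pi> \<in> permutations_of_set {1..n} \<Longrightarrow> h \<pi> \<in> permutations_of_set {1..n}"
    and "\<And>\<pi>. \<pi> \<in> permutations_of_set {1..n} \<Longrightarrow> h (h \<pi>) = \<pi>"
    and "\<And>\<pi>. \<pi> \<in> permutations_of_set {1..n} \<Longrightarrow> occurrences q1' (h \<pi>) = occurrences q1 \<pi>"
    and "\<And>\<pi>. \<pi> \<in> permutations_of_set {1..n} \<Longrightarrow> occurrences q2' (h \<pi>) = occurrences q2 \<pi>"
  shows "joint_distribution q1' q2' n k l = joint_distribution q1 q2 n k l"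
  unfolding joint_distribution_def
proof -
  let ?A = "\<lambda>q1 q2. {\<pi> \<in> permutations_of_set {1..n}. occurrences q1 \<pi> = k \<and> occurrences q2 \<pi> = l}"
  \<comment> \<open>The reverse transport comes from evaluating the assumptions at
    \<open>h \<pi>\<close>.\<close>
  have *: "occurrences q1 (h \<pi>) = occurrences q1' \<pi>" "occurrences q2 (h \<pi>) = occurrences q2' \<pi>"
    if "\<pi> \<in> permutations_of_set {1..n}" for \<pi>
    using assms(2-4) assms(1)[OF that] that by metis+
  have "bij_betw h (?A q1' q2') (?A q1 q2)"
    by (rule bij_betw_byWitness[where f' = h])
      (use assms * in \<open>auto simp del: One_nat_def\<close>)
  then show "card (?A q1' q2') = card (?A q1 q2)"
    by (rule bij_betw_same_card)
qed

lemma joint_distribution_commute: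
  "joint_distribution q1 q2 n k l = joint_distribution q2 q1 n l k"
  unfolding joint_distribution_def by (simp add: conj_commute)

section \<open>Inversion as transposition\<close>

definition inverse_list :: "nat list \<Rightarrow> nat list" where
  "inverse_list \<pi> = map (inv_into {1..length \<pi>} (entry \<pi>)) [1..<length \<pi> + 1]"

lemma inverse_list:
  assumes "\<pi> \<in> permutations_of_set {1..n}"
  shows "inverse_list \<pi> \<in> permutations_of_set {1..n}"
    and "i \<in> {1..n} \<Longrightarrow> entry (inverse_list \<pi>) i = inv_into {1..n} (entry \<pi>) i"
proof -
  have len: "length \<pi> = n" and bij: "bij_betw (entry \<pi>) {1..n} {1..n}"
    using permutation_facts[OF assms] by auto
  show entry: "entry (inverse_list \<pi>) i = inv_into {1..n} (entry \<pi>) i" if i: "i \<in> {1..n}" for i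
  proof -
    obtain j where "i = Suc j" "j < n" using i by (cases i) auto
    then show ?thesis by (simp add: entry_def inverse_list_def len del: upt_Suc)
  qed
  then have "bij_betw (entry (inverse_list \<pi>)) {1..n} {1..n}"
    using bij_betw_inv_into[OF bij] bij_betw_cong by metis
  moreover have "length (inverse_list \<pi>) = n"
    by (simp add: inverse_list_def len)
  ultimately show "inverse_list \<pi> \<in> permutations_of_set {1..n}"
    using permutations_of_set_atLeastAtMost_iff by blast
qed

lemma permutation_eqI:
  assumes "\<pi> \<in> permutations_of_set {1..n}" "\<rho> \<in> permutations_of_set {1..n}"
    and "\<And>i. i \<in> {1..n} \<Longrightarrow> entry \<pi> i = entry \<rho> i"
  shows "\<pi> = \<rho>"
proof (rule nth_equalityI)
  show "length \<pi> = length \<rho>" using assms length_permutation by metis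
  fix i assume "i < length \<pi>"
  then show "\<pi> ! i = \<rho> ! i"
    using assms(3)[of "Suc i"] length_permutation[OF assms(1)] by (simp add: entry_def)
qed

lemma inverse_list_involutive:
  assumes "\<pi> \<in> permutations_of_set {1..n}"
  shows "inverse_list (inverse_list \<pi>) = \<pi>"
proof (rule permutation_eqI[OF _ assms])
  have bij: "bij_betw (entry \<pi>) {1..n} {1..n}"
    using permutation_facts[OF assms] by auto
  note inv = inverse_list[OF assms] and inv2 = inverse_list[OF inverse_list(1)[OF assms]]
  show "inverse_list (inverse_list \<pi>) \<in> permutations_of_set {1..n}" by (rule inv2)
  fix i assume i: "i \<in> {1..n}"
  have inj: "inj_on (entry (inverse_list \<pi>)) {1..n}"
    using permutation_facts(2)[OF inv(1)] by (simp add: bij_betw_def)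
  have e: "entry \<pi> i \<in> {1..n}" using bij i bij_betwE by blast
  have "entry (inverse_list \<pi>) (entry \<pi> i) = i"
    using inv(2)[OF e] i bij by (simp add: bij_betw_def)
  then show "entry (inverse_list (inverse_list \<pi>)) i = entry \<pi> i"
    using inv2(2)[OF i] inv_into_f_eq[OF inj e] by simp
qed

lemma points_inverse_list:
  assumes "\<pi> \<in> permutations_of_set {1..n}"
  shows "points (inverse_list \<pi>) = prod.swap ` points \<pi>"
proof -
  have len: "length \<pi> = n" and bij: "bij_betw (entry \<pi>) {1..n} {1..n}"
    using permutation_facts[OF assms] by auto
  note inv = inverse_list[OF assms]
  have "points (inverse_list \<pi>) = (\<lambda>i. (i, inv_into {1..n} (entry \<pi>) i)) ` {1..n}"
    unfolding points_def length_permutation[OF inv(1)] using inv(2) by (intro image_cong) auto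
  \<comment> \<open>Indexing by values instead of positions makes the inverse cancel
    pointwise.\<close>
  also have "\<dots> = (\<lambda>i. (i, inv_into {1..n} (entry \<pi>) i)) ` (entry \<pi> ` {1..n})"
    using bij by (simp add: bij_betw_def)
  also have "(\<lambda>i. (i, inv_into {1..n} (entry \<pi>) i)) ` (entry \<pi> ` {1..n}) = prod.swap ` points \<pi>"
    unfolding points_def len image_image
    using bij by (intro image_cong) (auto simp: bij_betw_def)
  finally show ?thesis .
qed

lemma box_swap: "box (prod.swap ` T) (prod.swap r) = prod.swap (box T r)"
proof -
  have "{p \<in> prod.swap ` T. fst p < snd r} = prod.swap ` {p \<in> T. snd p < snd r}"
    "{p \<in> prod.swap ` T. snd p < fst r} = prod.swap ` {p \<in> T. fst p < fst r}" by auto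
  then show ?thesis by (simp add: box_def card_image)
qed

text \<open>Transposition exchanges the two ranks of every point. One inclusion is proved for
  arbitrary data; applying it to the transposed data gives the other, as \<open>prod.swap\<close> is
  an involution.\<close>

lemma occ_sets_swap:
  assumes "profile \<tau>' = prod.swap ` profile \<tau>"
  shows "occ_sets (\<tau>', R\<inverse>) (prod.swap ` P) = image prod.swap ` occ_sets (\<tau>, R) P"
proof -
  have sub: "image prod.swap ` occ_sets (\<tau>, R) P \<subseteq> occ_sets (\<tau>', R\<inverse>) (prod.swap ` P)"
    if "profile \<tau>' = prod.swap ` profile \<tau>" for \<tau> \<tau>' R and P :: "(nat \<times> nat) set"
  proof (intro image_subsetI)
    fix T assume T: "T \<in> occ_sets (\<tau>, R) P"
    have box: "box (prod.swap ` T) ` prod.swap ` A = prod.swap ` box T ` A" for A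
      by (simp add: image_image box_swap)
    have "prod.swap ` P - prod.swap ` T = prod.swap ` (P - T)"
      by (simp add: image_set_diff)
    moreover have "prod.swap ` A \<inter> R\<inverse> = {}" if "A \<inter> R = {}" for A
      using that by auto
    ultimately show "prod.swap ` T \<in> occ_sets (\<tau>', R\<inverse>) (prod.swap ` P)"
      using T that by (simp add: occ_sets_def box image_mono)
  qed
  have "profile \<tau> = prod.swap ` profile \<tau>'"
    using assms by (simp add: image_image)
  then have "image prod.swap ` occ_sets (\<tau>', R\<inverse>) (prod.swap ` P) \<subseteq> occ_sets (\<tau>, R) P"
    using sub[of \<tau> \<tau>' "R\<inverse>" "prod.swap ` P"] by (simp add: image_image)
  then have "image prod.swap ` image prod.swap ` occ_sets (\<tau>', R\<inverse>) (prod.swap ` P)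
      \<subseteq> image prod.swap ` occ_sets (\<tau>, R) P" by (rule image_mono)
  then show ?thesis
    using sub[OF assms, of R P] by (simp add: image_image)
qed

lemma occurrences_inverse_list:
  assumes "\<pi> \<in> permutations_of_set {1..n}" "is_mesh_pattern (\<tau>, R)" "is_mesh_pattern (\<tau>', R\<inverse>)"
    and "profile \<tau>' = prod.swap ` profile \<tau>"
  shows "occurrences (\<tau>', R\<inverse>) (inverse_list \<pi>) = occurrences (\<tau>, R) \<pi>"
proof -
  have "inj_on (image prod.swap) A" for A :: "(nat \<times> nat) set set"
    by (rule inj_onI) (simp add: inj_image_eq_iff)
  then show ?thesis
    using occurrences_eq[OF inverse_list(1)[OF assms(1)] assms(3)] occurrences_eq[OF assms(1,2)]
      occ_sets_swap[OF assms(4), of R "points \<pi>"]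
    by (simp add: points_inverse_list[OF assms(1)] card_image)
qed

lemma is_mesh_pattern_converse:
  "is_mesh_pattern (\<tau>, R) \<Longrightarrow> is_mesh_pattern (\<tau>, R\<inverse>)"
  by (auto simp: is_mesh_pattern_def Let_def)

text \<open>The condition on the profiles says that the underlying permutations are involutions, so
  inversion changes only the shadings.\<close>

lemma joint_distribution_converse:
  assumes "is_mesh_pattern (\<tau>1, R1)" "is_mesh_pattern (\<tau>2, R2)"
    and "(profile \<tau>1)\<inverse> = profile \<tau>1" "(profile \<tau>2)\<inverse> = profile \<tau>2"
  shows "joint_distribution (\<tau>1, R1\<inverse>) (\<tau>2, R2\<inverse>) n k l = joint_distribution (\<tau>1, R1) (\<tau>2, R2) n k l"
proof -
  have "A\<inverse> = prod.swap ` A" for A :: "(nat \<times> nat) set" by force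
  then have profiles: "profile \<tau>1 = prod.swap ` profile \<tau>1" "profile \<tau>2 = prod.swap ` profile \<tau>2"
    using assms(3,4) by metis+
  show ?thesis
  proof (rule joint_distribution_bij[where h = inverse_list])
    fix \<pi> assume \<pi>: "\<pi> \<in> permutations_of_set {1..n}"
    show "occurrences (\<tau>1, R1\<inverse>) (inverse_list \<pi>) = occurrences (\<tau>1, R1) \<pi>"
      using occurrences_inverse_list[OF \<pi> assms(1) is_mesh_pattern_converse[OF assms(1)] profiles(1)] .
    show "occurrences (\<tau>2, R2\<inverse>) (inverse_list \<pi>) = occurrences (\<tau>2, R2) \<pi>"
      using occurrences_inverse_list[OF \<pi> assms(2) is_mesh_pattern_converse[OF assms(2)] profiles(2)] .
  qed (fact inverse_list inverse_list_involutive)+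
qed

section \<open>Reversal as horizontal reflection\<close>

definition flip :: "nat \<Rightarrow> nat \<times> nat \<Rightarrow> nat \<times> nat" where
  "flip k p = (k - fst p, snd p)"

text \<open>Truncated subtraction makes the bound necessary. The width is \<open>n + 1\<close> for
  positions, \<open>length \<tau>\<close> for boxes and \<open>length \<tau> - 1\<close> for ranks
  inside an occurrence.\<close>

lemma flip_flip: "fst p \<le> k \<Longrightarrow> flip k (flip k p) = p"
  by (simp add: flip_def)

lemma flip_image_image: "fst ` A \<subseteq> {0..k} \<Longrightarrow> flip k ` flip k ` A = A"
  by (force simp: flip_def image_image)

lemma inj_on_flip: "inj_on (flip k) {p. fst p \<le> k}"
  by (rule inj_on_inverseI[where g = "flip k"]) (simp add: flip_flip)

lemma points_rev:
  "points (rev \<pi>) = flip (length \<pi> + 1) ` points \<pi>"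
proof -
  let ?n = "length \<pi>"
  have "bij_betw (\<lambda>i. ?n + 1 - i) {1..?n} {1..?n}"
    by (rule bij_betw_byWitness[where f' = "\<lambda>i. ?n + 1 - i"]) auto
  then have "(\<lambda>i. ?n + 1 - i) ` {1..?n} = {1..?n}"
    by (simp add: bij_betw_def)
  then have "points (rev \<pi>) = (\<lambda>i. (i, entry (rev \<pi>) i)) ` (\<lambda>i. ?n + 1 - i) ` {1..?n}"
    by (simp only: points_def length_rev)
  also have "\<dots> = (\<lambda>i. (?n + 1 - i, entry (rev \<pi>) (?n + 1 - i))) ` {1..?n}"
    by (simp only: image_image)
  also have "\<dots> = (\<lambda>i. (?n + 1 - i, entry \<pi> i)) ` {1..?n}"
    by (rule image_cong) (auto simp: entry_def rev_nth)
  finally show ?thesis by (simp add: points_def image_image flip_def)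
qed

text \<open>Among the points of \<open>T\<close> the rank runs only up to \<open>card T - 1\<close>, whereas the box index of a
  point outside \<open>T\<close> runs up to \<open>card T\<close>.\<close>

lemma box_flip:
  assumes P: "general_position P" "fst ` P \<subseteq> {1..n}" and T: "T \<subseteq> P" and r: "r \<in> P"
  shows "box (flip (n + 1) ` T) (flip (n + 1) r) = flip (card T - of_bool (r \<in> T)) (box T r)"
proof -
  let ?f = "flip (n + 1)"
  have le: "fst p \<in> {1..n}" if "p \<in> P" for p using that P(2) by blast
  have fin: "finite T" using P(1) T by (meson finite_subset general_position_def)
  have inj: "inj_on ?f T"
    by (rule inj_on_subset[OF inj_on_flip]) (use le T in fastforce)
  have "{p \<in> ?f ` T. fst p < fst (?f r)} = ?f ` {p \<in> T. fst r < fst p}"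
    using le T r by (force simp: flip_def)
  then have a: "card {p \<in> ?f ` T. fst p < fst (?f r)} = card {p \<in> T. fst r < fst p}"
    using inj by (simp add: card_image inj_on_subset)
  have "{p \<in> ?f ` T. snd p < snd (?f r)} = ?f ` {p \<in> T. snd p < snd r}"
    by (auto simp: flip_def)
  then have b: "card {p \<in> ?f ` T. snd p < snd (?f r)} = card {p \<in> T. snd p < snd r}"
    using inj by (simp add: card_image inj_on_subset)
  \<comment> \<open>By general position every other point of \<open>T\<close> lies strictly left or
    strictly right of \<open>r\<close>; the points on the right become those on the left after
    reflection.\<close>
  have "p = r" if "p \<in> T" "fst p = fst r" for p
    using P(1) that T r by (auto simp: general_position_def inj_on_def)
  then have "fst p < fst r \<or> fst r < fst p" if "p \<in> T" "p \<noteq> r" for p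
    using that by (meson nat_neq_iff)
  then have split: "T - {r} = {p \<in> T. fst p < fst r} \<union> {p \<in> T. fst r < fst p}"
    by blast
  have "card (T - {r}) = card {p \<in> T. fst p < fst r} + card {p \<in> T. fst r < fst p}"
    unfolding split by (rule card_Un_disjoint) (use fin in auto)
  moreover have "card T = card (T - {r}) + of_bool (r \<in> T)"
    using fin by (cases "r \<in> T") (simp_all add: card_Suc_Diff1 del: card_Diff_singleton card_Diff_insert)
  ultimately have "card T = card {p \<in> T. fst p < fst r} + card {p \<in> T. fst r < fst p} + of_bool (r \<in> T)"
    by simp
  then show ?thesis
    using a b by (simp add: box_def flip_def)
qed

text \<open>Points of the occurrence are reflected with width \<open>length \<tau> - 1\<close> and
  all others with width \<open>length \<tau>\<close>, so pattern and shading need different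
  flips.\<close>

lemma occ_sets_flip:
  assumes P: "general_position P" "fst ` P \<subseteq> {1..n}" and R: "fst ` R \<subseteq> {0..length \<tau>}"
    and \<tau>': "profile \<tau>' = flip (length \<tau> - 1) ` profile \<tau>"
    and T: "T \<in> occ_sets (\<tau>, R) P"
  shows "flip (n + 1) ` T \<in> occ_sets (\<tau>', flip (length \<tau>) ` R) (flip (n + 1) ` P)"
proof -
  let ?f = "flip (n + 1)" and ?k = "length \<tau>"
  have TP: "T \<subseteq> P" and prof: "box T ` T = profile \<tau>" and av: "box T ` (P - T) \<inter> R = {}"
    using T by (auto simp: occ_sets_def)
  have card: "card T = ?k" using card_occurrence[OF P(1) TP prof] .
  have fin: "finite T" using P(1) TP by (meson finite_subset general_position_def)
  have inj: "inj_on ?f P"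
    by (rule inj_on_subset[OF inj_on_flip]) (use P(2) in fastforce)
  have in_T: "box (?f ` T) (?f r) = flip (?k - 1) (box T r)" if "r \<in> T" for r
    using box_flip[OF P TP, of r] that TP card by auto
  have out_T: "box (?f ` T) (?f r) = flip ?k (box T r)" if "r \<in> P - T" for r
    using box_flip[OF P TP, of r] that card by auto
  have "box (?f ` T) ` ?f ` T = flip (?k - 1) ` box T ` T"
    using in_T by (auto simp: image_image)
  moreover have "?f ` P - ?f ` T = ?f ` (P - T)"
    using inj TP by (simp add: inj_on_image_set_diff)
  \<comment> \<open>\<open>flip ?k\<close> may merge first coordinates beyond \<open>?k\<close>;
    bounding both box and shading by \<open>?k\<close> allows it to be cancelled.\<close>
  moreover have "box (?f ` T) (?f r) \<notin> flip ?k ` R" if r: "r \<in> P - T" for r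
  proof
    assume "box (?f ` T) (?f r) \<in> flip ?k ` R"
    then obtain s where s: "s \<in> R" "flip ?k (box T r) = flip ?k s"
      using out_T[OF r] by auto
    have "fst (box T r) \<le> ?k"
      using card fin by (auto simp: box_def card_mono simp flip: card)
    moreover have "fst s \<le> ?k" using R s(1) by auto
    ultimately have "box T r = s" using s(2) inj_onD[OF inj_on_flip] by blast
    then show False using av s(1) r by blast
  qed
  then have "box (?f ` T) ` ?f ` (P - T) \<inter> flip ?k ` R = {}" by blast
  ultimately show ?thesis
    using TP prof \<tau>' by (simp add: occ_sets_def image_mono)
qed

lemma profile_rev:
  assumes "\<tau> \<noteq> []"
  shows "profile (rev \<tau>) = flip (length \<tau> - 1) ` profile \<tau>"
proof -
  let ?k = "length \<tau>"
  have "bij_betw (\<lambda>i. ?k - 1 - i) {..<?k} {..<?k}"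
    by (rule bij_betw_byWitness[where f' = "\<lambda>i. ?k - 1 - i"]) auto
  then have "(\<lambda>i. ?k - 1 - i) ` {..<?k} = {..<?k}"
    by (simp add: bij_betw_def)
  then have "profile (rev \<tau>) = (\<lambda>i. (i, rev \<tau> ! i - 1)) ` (\<lambda>i. ?k - 1 - i) ` {..<?k}"
    by (simp only: profile_def length_rev)
  also have "\<dots> = (\<lambda>i. (?k - 1 - i, rev \<tau> ! (?k - 1 - i) - 1)) ` {..<?k}"
    by (simp only: image_image)
  also have "\<dots> = (\<lambda>i. (?k - 1 - i, \<tau> ! i - 1)) ` {..<?k}"
    by (rule image_cong) (auto simp: rev_nth)
  finally show ?thesis by (simp add: profile_def image_image flip_def)
qed

lemma permutations_of_set_rev:
  "\<pi> \<in> permutations_of_set A \<Longrightarrow> rev \<pi> \<in> permutations_of_set A"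
  by (simp add: permutations_of_set_def)

lemma is_mesh_pattern_rev:
  "is_mesh_pattern (\<tau>, R) \<Longrightarrow> is_mesh_pattern (rev \<tau>, flip (length \<tau>) ` R)"
  by (auto simp: is_mesh_pattern_def Let_def permutations_of_set_rev flip_def)

text \<open>Reflection injects the occurrences into those of the reversed data, which gives one
  inequality; reversing once more gives the other.\<close>

lemma occurrences_rev:
  assumes \<pi>: "\<pi> \<in> permutations_of_set {1..n}" and q: "is_mesh_pattern (\<tau>, R)" and "\<tau> \<noteq> []"
  shows "occurrences (rev \<tau>, flip (length \<tau>) ` R) (rev \<pi>) = occurrences (\<tau>, R) \<pi>"
proof -
  have le: "occurrences (\<tau>, R) \<pi> \<le> occurrences (rev \<tau>, flip (length \<tau>) ` R) (rev \<pi>)"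
    if \<pi>: "\<pi> \<in> permutations_of_set {1..n}" and q: "is_mesh_pattern (\<tau>, R)" and "\<tau> \<noteq> []"
    for \<pi> \<tau> R
  proof -
    let ?P = "points \<pi>" and ?f = "flip (n + 1)"
    have len: "length \<pi> = n" using length_permutation[OF \<pi>] .
    have P: "general_position ?P" "fst ` ?P \<subseteq> {1..n}"
      using general_position_points[OF \<pi>] by (auto simp: points_def len)
    have R: "fst ` R \<subseteq> {0..length \<tau>}"
      using q by (auto simp: is_mesh_pattern_def Let_def)
    have inj: "inj_on ?f ?P"
      by (rule inj_on_subset[OF inj_on_flip]) (use P(2) in fastforce)
    have sub: "occ_sets q ?P \<subseteq> Pow ?P" for q by (auto simp: occ_sets_def)
    have "inj_on (image ?f) (occ_sets (\<tau>, R) ?P)"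
      by (rule inj_on_subset[OF inj_on_image_Pow[OF inj] sub])
    moreover have "image ?f ` occ_sets (\<tau>, R) ?P \<subseteq> occ_sets (rev \<tau>, flip (length \<tau>) ` R) (?f ` ?P)"
      using occ_sets_flip[OF P R profile_rev[OF \<open>\<tau> \<noteq> []\<close>]] by blast
    moreover have "finite (occ_sets (rev \<tau>, flip (length \<tau>) ` R) (?f ` ?P))"
      using P(1) by (auto simp: occ_sets_def general_position_def)
    ultimately have "card (occ_sets (\<tau>, R) ?P) \<le> card (occ_sets (rev \<tau>, flip (length \<tau>) ` R) (?f ` ?P))"
      by (rule card_inj_on_le)
    then show ?thesis
      using occurrences_eq[OF \<pi> q]
        occurrences_eq[OF permutations_of_set_rev[OF \<pi>] is_mesh_pattern_rev[OF q]]
      by (simp add: points_rev len)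
  qed
  have "flip (length \<tau>) ` flip (length \<tau>) ` R = R"
    using q by (intro flip_image_image) (auto simp: is_mesh_pattern_def Let_def)
  then have "occurrences (rev \<tau>, flip (length \<tau>) ` R) (rev \<pi>) \<le> occurrences (\<tau>, R) \<pi>"
    using le[OF permutations_of_set_rev[OF \<pi>] is_mesh_pattern_rev[OF q]] assms(3) by simp
  then show ?thesis using le[OF assms] by simp
qed

lemma joint_distribution_rev:
  assumes "is_mesh_pattern (\<tau>1, R1)" "is_mesh_pattern (\<tau>2, R2)" "\<tau>1 \<noteq> []" "\<tau>2 \<noteq> []"
  shows "joint_distribution (rev \<tau>1, flip (length \<tau>1) ` R1) (rev \<tau>2, flip (length \<tau>2) ` R2) n k l =
         joint_distribution (\<tau>1, R1) (\<tau>2, R2) n k l"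
proof (rule joint_distribution_bij[where h = rev])
  fix \<pi> assume \<pi>: "\<pi> \<in> permutations_of_set {1..n}"
  show "rev \<pi> \<in> permutations_of_set {1..n}" using permutations_of_set_rev[OF \<pi>] .
  show "rev (rev \<pi>) = \<pi>" by simp
  show "occurrences (rev \<tau>1, flip (length \<tau>1) ` R1) (rev \<pi>) = occurrences (\<tau>1, R1) \<pi>"
    using occurrences_rev[OF \<pi> assms(1,3)] .
  show "occurrences (rev \<tau>2, flip (length \<tau>2) ` R2) (rev \<pi>) = occurrences (\<tau>2, R2) \<pi>"
    using occurrences_rev[OF \<pi> assms(2,4)] .
qed


section \<open>Patterns whose first letter is the minimum\<close>

lemma box_embedding:
  assumes fst_h: "\<And>p q. p \<in> P \<Longrightarrow> q \<in> P \<Longrightarrow> fst (h p) < fst (h q) \<longleftrightarrow> fst p < fst q"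
    and snd_h: "\<And>p q. p \<in> P \<Longrightarrow> q \<in> P \<Longrightarrow> snd (h p) < snd (h q) \<longleftrightarrow> snd p < snd q"
    and inj: "inj_on h P" and "T \<subseteq> P" "r \<in> P"
  shows "box (h ` T) (h r) = box T r"
proof -
  have "{p \<in> h ` T. fst p < fst (h r)} = h ` {p \<in> T. fst p < fst r}"
    "{p \<in> h ` T. snd p < snd (h r)} = h ` {p \<in> T. snd p < snd r}"
    using assms by blast+
  moreover have "inj_on h A" if "A \<subseteq> T" for A
    using inj_on_subset[OF inj] that \<open>T \<subseteq> P\<close> by blast
  ultimately show ?thesis by (simp add: box_def card_image)
qed

text \<open>Only the relative order of the coordinates matters for occurrences, so a point set may
  be standardized without changing their number.\<close>

lemma card_occ_sets_embedding:
  assumes P: "general_position P"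
    and fst_h: "\<And>p q. p \<in> P \<Longrightarrow> q \<in> P \<Longrightarrow> fst (h p) < fst (h q) \<longleftrightarrow> fst p < fst q"
    and snd_h: "\<And>p q. p \<in> P \<Longrightarrow> q \<in> P \<Longrightarrow> snd (h p) < snd (h q) \<longleftrightarrow> snd p < snd q"
  shows "card (occ_sets q (h ` P)) = card (occ_sets q P)"
proof -
  have inj: "inj_on h P"
  proof (rule inj_onI)
    fix p q assume pq: "p \<in> P" "q \<in> P" "h p = h q"
    then have "fst p = fst q"
      using fst_h[OF pq(1,2)] fst_h[OF pq(2,1)] by simp
    then show "p = q" using P pq by (auto simp: general_position_def dest: inj_onD)
  qed
  have mem: "h ` T \<in> occ_sets q (h ` P) \<longleftrightarrow> T \<in> occ_sets q P" if T: "T \<subseteq> P" for T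
  proof -
    have box: "box (h ` T) ` h ` A = box T ` A" if "A \<subseteq> P" for A
      using box_embedding[OF fst_h snd_h inj T] that by (force simp: image_image)
    have "h ` P - h ` T = h ` (P - T)"
      using inj T by (simp add: inj_on_image_set_diff)
    then show ?thesis
      using T box[OF T] box[of "P - T"] by (simp add: occ_sets_def image_mono)
  qed
  have "occ_sets q P \<subseteq> Pow P" by (auto simp: occ_sets_def)
  then have "inj_on (image h) (occ_sets q P)"
    by (rule inj_on_subset[OF inj_on_image_Pow[OF inj]])
  moreover have "occ_sets q (h ` P) = image h ` occ_sets q P"
  proof (intro equalityI subsetI)
    fix T' assume T': "T' \<in> occ_sets q (h ` P)"
    then have "T' \<subseteq> h ` P" by (simp add: occ_sets_def)
    then obtain T where "T \<subseteq> P" "T' = h ` T" by (rule subset_imageE)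
    then show "T' \<in> image h ` occ_sets q P" using T' mem by blast
  next
    fix T' assume "T' \<in> image h ` occ_sets q P"
    then obtain T where "T \<in> occ_sets q P" "T' = h ` T" by blast
    then show "T' \<in> occ_sets q (h ` P)" using mem[of T] by (simp add: occ_sets_def)
  qed
  ultimately show ?thesis by (simp add: card_image)
qed

text \<open>Column 0 is fully shaded and the rest of row 0 is left free. Starting from length two,
  this is the shape of the shadings \<open>shadeX j\<close>.\<close>

definition prepend_min :: "mesh_pattern \<Rightarrow> mesh_pattern" where
  "prepend_min q =
     (1 # map Suc (fst q), {0} \<times> {0..Suc (length (fst q))} \<union> map_prod Suc Suc ` snd q)"

lemma is_mesh_patternD:
  assumes "is_mesh_pattern q"
  shows "set (fst q) = {1..length (fst q)}" and "distinct (fst q)"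
    and "snd q \<subseteq> {0..length (fst q)} \<times> {0..length (fst q)}"
  using assms permutations_of_setD unfolding is_mesh_pattern_def Let_def by blast+

lemma profile_prepend_min:
  assumes "is_mesh_pattern q"
  shows "profile (fst (prepend_min q)) = insert (0, 0) (map_prod Suc Suc ` profile (fst q))"
proof -
  let ?\<tau> = "fst q"
  have pos: "Suc (?\<tau> ! i - 1) = ?\<tau> ! i" if "i < length ?\<tau>" for i
  proof -
    have "?\<tau> ! i \<in> set ?\<tau>" using that by simp
    then have "?\<tau> ! i \<in> {1..length ?\<tau>}" using is_mesh_patternD(1)[OF assms] by blast
    then show ?thesis by auto
  qed
  have "profile (1 # map Suc ?\<tau>) =
      insert (0, 0) ((\<lambda>i. (Suc i, ?\<tau> ! i)) ` {..<length ?\<tau>})"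
    by (simp add: profile_def lessThan_Suc_eq_insert_0 image_image)
  also have "(\<lambda>i. (Suc i, ?\<tau> ! i)) ` {..<length ?\<tau>} = map_prod Suc Suc ` profile ?\<tau>"
    unfolding profile_def image_image using pos by (intro image_cong) auto
  finally show ?thesis by (simp add: prepend_min_def)
qed

lemma is_mesh_pattern_prepend_min:
  assumes "is_mesh_pattern q"
  shows "is_mesh_pattern (prepend_min q)"
proof -
  let ?\<tau> = "fst q"
  note \<tau> = is_mesh_patternD(1,2)[OF assms] and R = is_mesh_patternD(3)[OF assms]
  have "Suc ` {1..m} = {2..Suc m}" for m by (simp add: numeral_2_eq_2)
  then have "set (1 # map Suc ?\<tau>) = {1..Suc (length ?\<tau>)}"
    using \<tau>(1) by auto
  moreover have "distinct (1 # map Suc ?\<tau>)"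
    using \<tau> by (auto simp: distinct_map)
  ultimately show ?thesis
    using R by (auto simp: is_mesh_pattern_def prepend_min_def Let_def permutations_of_set_def)
qed

text \<open>Since column 0 is shaded, every occurrence uses the leftmost point \<open>p0\<close>. As
  \<open>p0\<close> is the minimum of the occurrence and no box of row 0 to its right is shaded,
  the points below \<open>p0\<close> are irrelevant.\<close>

lemma card_occ_sets_prepend_min:
  assumes q: "is_mesh_pattern q" and P: "general_position P" and p0: "p0 \<in> P"
    and leftmost: "\<And>p. p \<in> P \<Longrightarrow> p \<noteq> p0 \<Longrightarrow> fst p0 < fst p"
  shows "card (occ_sets (prepend_min q) P) = card (occ_sets q {p \<in> P. snd p0 < snd p})"
proof -
  define L where "L = {p \<in> P. snd p0 < snd p}"
  let ?s = "map_prod Suc Suc" and ?\<tau> = "fst q"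
  have LP: "L \<subseteq> P" "p0 \<notin> L" by (auto simp: L_def)
  have L_above: "fst p0 < fst p \<and> snd p0 < snd p" if "p \<in> L" for p
    using leftmost[of p] that unfolding L_def by blast
  have fin: "finite T" if "T \<subseteq> P" for T
    using P that by (meson finite_subset general_position_def)
  \<comment> \<open>A point above and to the right of \<open>p0\<close> gains one in each rank when
    \<open>p0\<close> joins the set.\<close>
  have box_L: "box (insert p0 T) r = ?s (box T r)" if "T \<subseteq> L" "r \<in> L" for T r
  proof -
    have "fst p0 < fst r" "snd p0 < snd r"
      using L_above[OF \<open>r \<in> L\<close>] by simp_all
    then have "{p \<in> insert p0 T. fst p < fst r} = insert p0 {p \<in> T. fst p < fst r}"
      "{p \<in> insert p0 T. snd p < snd r} = insert p0 {p \<in> T. snd p < snd r}" by auto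
    moreover have "finite T" "p0 \<notin> T" using that LP fin by blast+
    ultimately show ?thesis by (simp add: box_def)
  qed
  have box_p0: "box (insert p0 T) p0 = (0, 0)" if "T \<subseteq> L" for T
  proof -
    have "fst p0 < fst p \<and> snd p0 < snd p" if "p \<in> T" for p
      using that \<open>T \<subseteq> L\<close> L_above by blast
    then have none: "{p \<in> insert p0 T. fst p < fst p0} = {}" "{p \<in> insert p0 T. snd p < snd p0} = {}"
      by fastforce+
    show ?thesis unfolding box_def none by simp
  qed
  \<comment> \<open>Such a point is to the right of \<open>p0\<close> and below the whole candidate
    occurrence, hence in row 0 outside column 0, where nothing is shaded.\<close>
  have box_below: "box (insert p0 T) r \<notin> snd (prepend_min q)"
    if "T \<subseteq> L" "r \<in> P" "r \<noteq> p0" "r \<notin> L" for T r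
  proof -
    have "finite (insert p0 T)" using that LP fin by blast
    moreover have "fst p0 < fst r" using that leftmost by blast
    then have "p0 \<in> {p \<in> insert p0 T. fst p < fst r}" by simp
    ultimately have "fst (box (insert p0 T) r) \<noteq> 0"
      unfolding box_def fst_conv by (subst card_eq_0_iff) (blast intro: finite_subset)
    moreover have "snd r \<le> snd p" if "p \<in> insert p0 T" for p
      using that \<open>T \<subseteq> L\<close> \<open>r \<in> P\<close> \<open>r \<notin> L\<close> by (auto simp: L_def)
    then have none: "{p \<in> insert p0 T. snd p < snd r} = {}" by fastforce
    have "snd (box (insert p0 T) r) = 0"
      unfolding box_def none by simp
    ultimately show ?thesis by (auto simp: prepend_min_def)
  qed
  have inj_s: "inj ?s" by (simp add: prod.inj_map)
  have shade_s: "?s b \<in> snd (prepend_min q) \<longleftrightarrow> b \<in> snd q" for b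
    using inj_s by (cases b) (auto simp: prepend_min_def)
  have mem: "insert p0 T \<in> occ_sets (prepend_min q) P \<longleftrightarrow> T \<in> occ_sets q L" if T: "T \<subseteq> L" for T
  proof -
    have "box (insert p0 T) ` insert p0 T = insert (0, 0) (?s ` box T ` T)"
      using box_L[OF T] box_p0[OF T] T by (force simp: image_image)
    \<comment> \<open>Shifted pairs have positive coordinates, so the rank \<open>(0, 0)\<close> of
      \<open>p0\<close> can be cancelled from both sides.\<close>
    moreover have "insert (0, 0) (?s ` A) = insert (0, 0) (?s ` B) \<longleftrightarrow> A = B" for A B
    proof -
      have "(0, 0) \<notin> ?s ` A" "(0, 0) \<notin> ?s ` B" by auto
      then show ?thesis using inj_s by (simp add: insert_ident inj_image_eq_iff)
    qed
    ultimately have "box (insert p0 T) ` insert p0 T = profile (fst (prepend_min q)) \<longleftrightarrow>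
        box T ` T = profile ?\<tau>"
      by (simp add: profile_prepend_min[OF q])
    moreover have "box (insert p0 T) ` (P - insert p0 T) \<inter> snd (prepend_min q) = {} \<longleftrightarrow>
        box T ` (L - T) \<inter> snd q = {}"
    proof -
      have "box (insert p0 T) r \<notin> snd (prepend_min q) \<longleftrightarrow> box T r \<notin> snd q" if "r \<in> L" for r
        using box_L[OF T that] shade_s by simp
      then show ?thesis using box_below[OF T] LP by blast
    qed
    moreover have "insert p0 T \<subseteq> P" using T LP p0 by blast
    ultimately show ?thesis
      using T unfolding occ_sets_def mem_Collect_eq by blast
  qed
  have decompose: "p0 \<in> T \<and> T - {p0} \<subseteq> L" if T: "T \<in> occ_sets (prepend_min q) P" for T
  proof
    have TP: "T \<subseteq> P" and prof: "box T ` T = profile (fst (prepend_min q))"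
      and av: "box T ` (P - T) \<inter> snd (prepend_min q) = {}"
      using T by (auto simp: occ_sets_def)
    have none_left: "{p \<in> T. fst p < fst p0} = {}"
      using TP leftmost by (metis (mono_tags, lifting) Collect_empty_eq less_asym less_irrefl subsetD)
    have fst0: "fst (box T p0) = 0" unfolding box_def none_left by simp
    have "card T = Suc (length ?\<tau>)"
      using card_occurrence[OF P TP prof] by (simp add: prepend_min_def)
    \<comment> \<open>The shading of column 0 ends at row \<open>Suc (length ?\<tau>)\<close>; this
      bound is what places \<open>p0\<close> in a shaded box, so that \<open>p0\<close> must belong
      to \<open>T\<close>.\<close>
    then have "snd (box T p0) \<le> Suc (length ?\<tau>)"
      using card_mono[OF fin[OF TP], of "{p \<in> T. snd p < snd p0}"] by (simp add: box_def)
    then have "box T p0 \<in> snd (prepend_min q)"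
      using fst0 by (cases "box T p0") (simp add: prepend_min_def)
    then show p0T: "p0 \<in> T" using av p0 by blast
    \<comment> \<open>The only rank pair with first coordinate 0 is \<open>(0, 0)\<close>, so
      \<open>p0\<close> is also the lowest point of \<open>T\<close>.\<close>
    then have "box T p0 \<in> insert (0, 0) (?s ` profile ?\<tau>)"
      using prof profile_prepend_min[OF q] by blast
    then have "box T p0 = (0, 0)" using fst0 by auto
    then have none: "{p \<in> T. snd p < snd p0} = {}"
      using fin[OF TP] by (simp add: box_def)
    show "T - {p0} \<subseteq> L"
    proof
      fix p assume p: "p \<in> T - {p0}"
      then have "snd p \<noteq> snd p0"
        using P TP p0 by (auto simp: general_position_def dest: inj_onD)
      moreover have "\<not> snd p < snd p0" "p \<in> P" using none p TP by blast+
      ultimately show "p \<in> L" by (simp add: L_def)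
    qed
  qed
  have "bij_betw (insert p0) (occ_sets q L) (occ_sets (prepend_min q) P)"
  proof (rule bij_betw_byWitness[where f' = "\<lambda>T. T - {p0}"])
    have sub: "T \<subseteq> L" if "T \<in> occ_sets q L" for T using that by (simp add: occ_sets_def)
    then show "\<forall>T \<in> occ_sets q L. insert p0 T - {p0} = T" using LP by blast
    show "\<forall>T \<in> occ_sets (prepend_min q) P. insert p0 (T - {p0}) = T" using decompose by blast
    show "insert p0 ` occ_sets q L \<subseteq> occ_sets (prepend_min q) P" using mem sub by blast
    show "(\<lambda>T. T - {p0}) ` occ_sets (prepend_min q) P \<subseteq> occ_sets q L"
      using mem decompose by (metis (no_types, lifting) image_subsetI insert_Diff)
  qed
  then show ?thesis unfolding L_def by (metis bij_betw_same_card)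
qed

text \<open>For a permutation of \<open>{1..n}\<close> the letters above the first one form an
  interval, so subtracting \<open>hd \<pi>\<close> already standardizes them.\<close>

definition above_first :: "nat list \<Rightarrow> nat list" where
  "above_first \<pi> = map (\<lambda>v. v - hd \<pi>) (filter (\<lambda>v. hd \<pi> < v) \<pi>)"

lemma entry_map: "i \<in> {1..length xs} \<Longrightarrow> entry (map f xs) i = f (entry xs i)"
  by (cases i) (simp_all add: entry_def)

text \<open>\<open>f\<close> enumerates the surviving positions in increasing order; it is the
  horizontal coordinate change from the filtered word back to the original.\<close>

lemma filter_positions:
  obtains f where "\<And>i j. i \<in> {1..length (filter Q xs)} \<Longrightarrow> j \<in> {1..length (filter Q xs)} \<Longrightarrow>
      f i < f j \<longleftrightarrow> i < j"
    and "f ` {1..length (filter Q xs)} = {i \<in> {1..length xs}. Q (entry xs i)}"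
    and "\<And>i. i \<in> {1..length (filter Q xs)} \<Longrightarrow> entry (filter Q xs) i = entry xs (f i)"
proof -
  define js where "js = filter (\<lambda>i. Q (entry xs i)) [1..<length xs + 1]"
  have "xs = map (entry xs) [1..<length xs + 1]"
    by (rule nth_equalityI) (simp_all add: entry_def del: upt_Suc)
  then have eq: "filter Q xs = map (entry xs) js"
    unfolding js_def by (metis (no_types, lifting) filter_map filter_cong comp_apply)
  have sorted: "sorted_wrt (<) js"
    unfolding js_def by (intro sorted_wrt_filter sorted_wrt_upt)
  have len: "length (filter Q xs) = length js" using eq by simp
  show thesis
  proof (rule that[of "entry js"])
    show "entry js i < entry js j \<longleftrightarrow> i < j"
      if "i \<in> {1..length (filter Q xs)}" "j \<in> {1..length (filter Q xs)}" for i j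
    proof -
      obtain i' j' where ij: "i = Suc i'" "j = Suc j'"
        using \<open>i \<in> _\<close> \<open>j \<in> _\<close> by (cases i; cases j) auto
      show ?thesis
        using sorted_wrt_nth_less[OF sorted, of i' j'] sorted_wrt_nth_less[OF sorted, of j' i'] that
        unfolding len entry_def ij by (cases i' j' rule: linorder_cases) auto
    qed
    have "entry js ` {1..length js} = set js"
    proof -
      have "{1..length js} = Suc ` {..<length js}" by (simp add: image_Suc_lessThan)
      then have "entry js ` {1..length js} = (!) js ` {..<length js}"
        by (simp only: image_image entry_def) simp
      then show ?thesis by (auto simp: set_conv_nth)
    qed
    also have "set js = {i \<in> {1..length xs}. Q (entry xs i)}"
      unfolding js_def by auto
    finally show "entry js ` {1..length (filter Q xs)} = {i \<in> {1..length xs}. Q (entry xs i)}"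
      unfolding len .
    show "entry (filter Q xs) i = entry xs (entry js i)" if "i \<in> {1..length (filter Q xs)}" for i
      unfolding eq using that len by (intro entry_map) simp
  qed
qed

lemma above_first_permutation:
  assumes "\<pi> \<in> permutations_of_set {1..n}"
  shows "above_first \<pi> \<in> permutations_of_set {1..n - hd \<pi>}"
proof -
  have \<pi>: "set \<pi> = {1..n}" "distinct \<pi>" using assms permutations_of_setD by blast+
  have "(\<lambda>v. v - hd \<pi>) ` {v \<in> {1..n}. hd \<pi> < v} = {1..n - hd \<pi>}"
  proof (intro equalityI subsetI)
    fix w assume "w \<in> {1..n - hd \<pi>}"
    then show "w \<in> (\<lambda>v. v - hd \<pi>) ` {v \<in> {1..n}. hd \<pi> < v}"
      by (intro image_eqI[of _ _ "w + hd \<pi>"]) auto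
  qed auto
  moreover have "inj_on (\<lambda>v. v - hd \<pi>) {v \<in> {1..n}. hd \<pi> < v}"
    by (rule inj_onI) auto
  ultimately show ?thesis
    using \<pi> by (auto simp: above_first_def permutations_of_set_def distinct_map)
qed

text \<open>The leftmost point is \<open>(1, hd \<pi>)\<close>, and the points above it are an
  order-preserving image of those of \<open>above_first \<pi>\<close>.\<close>

lemma occurrences_prepend_min:
  assumes \<pi>: "\<pi> \<in> permutations_of_set {1..n}" and "n > 0" and q: "is_mesh_pattern q"
  shows "occurrences (prepend_min q) \<pi> = occurrences q (above_first \<pi>)"
proof -
  define a where "a = hd \<pi>"
  have len: "length \<pi> = n" using length_permutation[OF \<pi>] .
  have first: "entry \<pi> 1 = a" using \<open>n > 0\<close> len hd_conv_nth[of \<pi>] by (auto simp: a_def entry_def)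
  let ?L = "{p \<in> points \<pi>. a < snd p}"
  have "card (occ_sets (prepend_min q) (points \<pi>)) =
      card (occ_sets q {p \<in> points \<pi>. snd (1::nat, a) < snd p})"
  proof (rule card_occ_sets_prepend_min[OF q general_position_points[OF \<pi>]])
    show "(1, a) \<in> points \<pi>" 
      unfolding points_def len using first \<open>n > 0\<close> by (intro image_eqI[of _ _ 1]) simp_all
    show "fst (1, a) < fst p" if "p \<in> points \<pi>" "p \<noteq> (1, a)" for p
      using that first by (auto simp: points_def not_less le_Suc_eq)
  qed
  also have "\<dots> = card (occ_sets q (points (above_first \<pi>)))"
  proof -
    obtain f where f: "\<And>i j. i \<in> {1..length (filter ((<) a) \<pi>)} \<Longrightarrow>
          j \<in> {1..length (filter ((<) a) \<pi>)} \<Longrightarrow> f i < f j \<longleftrightarrow> i < j"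
      and f_im: "f ` {1..length (filter ((<) a) \<pi>)} = {i \<in> {1..length \<pi>}. a < entry \<pi> i}"
      and f_entry: "\<And>i. i \<in> {1..length (filter ((<) a) \<pi>)} \<Longrightarrow>
          entry (filter ((<) a) \<pi>) i = entry \<pi> (f i)"
      using filter_positions[of "(<) a" \<pi>] by blast
    let ?m = "length (filter ((<) a) \<pi>)"
    \<comment> \<open>\<open>h\<close> undoes the standardization: \<open>f\<close> restores the
      positions, adding \<open>a\<close> restores the values.\<close>
    define h where "h = map_prod f (\<lambda>v. v + a)"
    have len': "length (above_first \<pi>) = ?m" by (simp add: above_first_def a_def)
    have entry: "entry (above_first \<pi>) i + a = entry \<pi> (f i)" if "i \<in> {1..?m}" for i
    proof -
      have "a < entry \<pi> (f i)" using that f_im by blast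
      moreover have "entry (above_first \<pi>) i = entry (filter ((<) a) \<pi>) i - a"
        using that unfolding above_first_def a_def by (intro entry_map)
      ultimately show ?thesis using f_entry[OF that] by simp
    qed
    have "h ` points (above_first \<pi>) = (\<lambda>i. (f i, entry (above_first \<pi>) i + a)) ` {1..?m}"
      by (simp add: h_def points_def len' image_image)
    also have "\<dots> = (\<lambda>i. (f i, entry \<pi> (f i))) ` {1..?m}"
      by (rule image_cong[OF refl]) (simp only: entry)
    also have "\<dots> = (\<lambda>i. (i, entry \<pi> i)) ` f ` {1..?m}"
      by (simp only: image_image)
    also have "\<dots> = ?L" unfolding f_im points_def by auto
    finally have "h ` points (above_first \<pi>) = ?L" .
    moreover have "card (occ_sets q (h ` points (above_first \<pi>))) = card (occ_sets q (points (above_first \<pi>)))"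
    proof (rule card_occ_sets_embedding)
      show "general_position (points (above_first \<pi>))"
        using general_position_points[OF above_first_permutation[OF \<pi>]] .
      fix p p' assume "p \<in> points (above_first \<pi>)" "p' \<in> points (above_first \<pi>)"
      then have "fst p \<in> {1..?m}" "fst p' \<in> {1..?m}" by (auto simp: points_def len')
      then show "fst (h p) < fst (h p') \<longleftrightarrow> fst p < fst p'"
        using f by (simp add: h_def)
      show "snd (h p) < snd (h p') \<longleftrightarrow> snd p < snd p'" by (simp add: h_def)
    qed
    ultimately show ?thesis by simp
  qed
  finally show ?thesis
    using occurrences_eq[OF \<pi> is_mesh_pattern_prepend_min[OF q]]
      occurrences_eq[OF above_first_permutation[OF \<pi>] q] by simp
qed


section \<open>Fibres of the reduction\<close>

text \<open>Such words are the shuffles of \<open>us\<close> with an arrangement of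
  \<open>B\<close>. The factorial counts the arrangements and the binomial coefficient the shuffles
  of each.\<close>

lemma card_permutations_with_filter:
  assumes fin: "finite B" and disj: "A \<inter> B = {}" and us: "us \<in> permutations_of_set A"
  shows "card {xs \<in> permutations_of_set (A \<union> B). filter (\<lambda>x. x \<in> A) xs = us} =
         fact (card B) * ((card A + card B) choose card A)"
proof -
  have us': "set us = A" "distinct us" "length us = card A"
    using permutations_of_setD[OF us] distinct_card[of us] by simp_all
  have eq: "{xs \<in> permutations_of_set (A \<union> B). filter (\<lambda>x. x \<in> A) xs = us} =
      (\<Union>ys \<in> permutations_of_set B. shuffles us ys)" (is "?L = ?R")
  proof (intro equalityI subsetI)
    fix xs assume "xs \<in> ?L"
    then have xs: "set xs = A \<union> B" "distinct xs" "filter (\<lambda>x. x \<in> A) xs = us"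
      using permutations_of_setD by blast+
    then have "filter (\<lambda>x. x \<notin> A) xs \<in> permutations_of_set B"
      using disj by (auto simp: permutations_of_set_def)
    moreover have "xs \<in> shuffles us (filter (\<lambda>x. x \<notin> A) xs)"
      using partition_in_shuffles[of xs "\<lambda>x. x \<in> A"] xs(3) by simp
    ultimately show "xs \<in> ?R" by blast
  next
    fix xs assume "xs \<in> ?R"
    then obtain ys where ys: "set ys = B" "distinct ys" "xs \<in> shuffles us ys"
      using permutations_of_setD by blast
    have "set us \<inter> set ys = {}" using us' ys disj by simp
    then show "xs \<in> ?L"
      using distinct_disjoint_shuffles[OF us'(2) ys(2) _ ys(3)] set_shuffles[OF ys(3)]
        filter_shuffles_disjoint1(1)[OF _ ys(3)] us' ys(1)
      by (simp add: permutations_of_set_def)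
  qed
  have ys_facts: "set us \<inter> set ys = {}" "length ys = card B" if "ys \<in> permutations_of_set B" for ys
    using permutations_of_setD[OF that] distinct_card[of ys] us'(1) disj by simp_all
  have "card ?R = (\<Sum>ys \<in> permutations_of_set B. card (shuffles us ys))"
  proof (rule card_UN_disjoint)
    \<comment> \<open>A shuffle determines \<open>ys\<close> as its subsequence of letters outside
      \<open>us\<close>.\<close>
    show "\<forall>ys \<in> permutations_of_set B. \<forall>ys' \<in> permutations_of_set B.
        ys \<noteq> ys' \<longrightarrow> shuffles us ys \<inter> shuffles us ys' = {}"
      using filter_shuffles_disjoint1(2) ys_facts(1) by (metis disjoint_iff)
  qed (use fin in auto)
  also have "\<dots> = (\<Sum>ys \<in> permutations_of_set B. (card A + card B) choose card A)"
    using ys_facts us'(3) by (intro sum.cong refl) (simp add: card_disjoint_shuffles)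
  finally show ?thesis using eq fin by simp
qed

text \<open>After the leading \<open>a\<close>, the order of the larger letters is prescribed by
  \<open>\<sigma>\<close>, and the \<open>a - 1\<close> smaller ones are shuffled in freely. The
  count does not depend on \<open>\<sigma>\<close>.\<close>

lemma card_above_first_fibre:
  assumes a: "a \<in> {1..n}" and \<sigma>: "\<sigma> \<in> permutations_of_set {1..n - a}"
  shows "card {\<pi> \<in> permutations_of_set {1..n}. hd \<pi> = a \<and> above_first \<pi> = \<sigma>} =
         fact (a - 1) * ((n - 1) choose (n - a))"
proof -
  let ?A = "{a<..n}" and ?B = "{1..<a}"
  define us where "us = map (\<lambda>v. v + a) \<sigma>"
  have "(\<lambda>v. v + a) ` {1..n - a} = ?A"
  proof (intro equalityI subsetI)
    fix w assume "w \<in> ?A"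
    then show "w \<in> (\<lambda>v. v + a) ` {1..n - a}" by (intro image_eqI[of _ _ "w - a"]) auto
  qed (use a in auto)
  then have us: "us \<in> permutations_of_set ?A"
    using \<sigma> permutations_of_setD[OF \<sigma>] by (simp add: us_def permutations_of_set_def distinct_map)
  have AB: "{1..n} = insert a (?A \<union> ?B)" "a \<notin> ?A \<union> ?B" using a by auto
  have above: "above_first (a # xs) = \<sigma> \<longleftrightarrow> filter (\<lambda>x. x \<in> ?A) xs = us"
    if "xs \<in> permutations_of_set (?A \<union> ?B)" for xs
  proof -
    have "filter (\<lambda>x. x \<in> ?A) xs = filter ((<) a) xs"
      using permutations_of_setD(1)[OF that] by (intro filter_cong) auto
    moreover have "map (\<lambda>v. v - a) ys = \<sigma> \<longleftrightarrow> ys = us" if "\<forall>y \<in> set ys. a < y" for ys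
    proof -
      have "map (\<lambda>v. v + a) (map (\<lambda>v. v - a) ys) = ys"
        unfolding map_map by (rule map_idI) (use that in auto)
      moreover have "map (\<lambda>v. v - a) us = \<sigma>" by (simp add: us_def comp_def)
      ultimately show ?thesis unfolding us_def by metis
    qed
    ultimately show ?thesis by (simp add: above_first_def)
  qed
  have "{\<pi> \<in> permutations_of_set {1..n}. hd \<pi> = a \<and> above_first \<pi> = \<sigma>} =
      (#) a ` {xs \<in> permutations_of_set (?A \<union> ?B). filter (\<lambda>x. x \<in> ?A) xs = us}" (is "?L = ?R")
  proof (intro equalityI subsetI)
    fix \<pi> assume \<pi>: "\<pi> \<in> ?L"
    then have set: "set \<pi> = insert a (?A \<union> ?B)" "distinct \<pi>" and "hd \<pi> = a" "above_first \<pi> = \<sigma>"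
      using permutations_of_setD AB(1) by blast+
    then obtain xs where xs: "\<pi> = a # xs" by (cases \<pi>) auto
    then have "xs \<in> permutations_of_set (?A \<union> ?B)"
      using set AB(2) by (auto simp: permutations_of_set_def)
    then show "\<pi> \<in> ?R"
      using above[of xs] xs \<open>above_first \<pi> = \<sigma>\<close> by simp
  next
    fix \<pi> assume "\<pi> \<in> ?R"
    then obtain xs where xs: "\<pi> = a # xs" "xs \<in> permutations_of_set (?A \<union> ?B)"
      "filter (\<lambda>x. x \<in> ?A) xs = us" by blast
    then have "\<pi> \<in> permutations_of_set {1..n}"
      unfolding AB(1) using AB(2) permutations_of_setD[OF xs(2)]
      by (simp add: permutations_of_set_def)
    then show "\<pi> \<in> ?L" using above[OF xs(2)] xs by simp
  qed
  moreover have "inj_on ((#) a) S" for S by simp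
  ultimately have "card ?L = card {xs \<in> permutations_of_set (?A \<union> ?B). filter (\<lambda>x. x \<in> ?A) xs = us}"
    by (simp only: card_image)
  also have "\<dots> = fact (card ?B) * ((card ?A + card ?B) choose card ?A)"
    by (rule card_permutations_with_filter[OF _ _ us]) auto
  also have "\<dots> = fact (a - 1) * ((n - 1) choose (n - a))"
    using a by simp
  finally show ?thesis .
qed

text \<open>The permutations are sorted by first letter and by \<open>above_first\<close>. As the
  fibres have equal size for a fixed first letter, the weights do not depend on the
  patterns.\<close>

lemma joint_distribution_prepend_min:
  assumes q: "is_mesh_pattern q1" "is_mesh_pattern q2" and "n > 0"
  shows "joint_distribution (prepend_min q1) (prepend_min q2) n k l =
    (\<Sum>a = 1..n. fact (a - 1) * ((n - 1) choose (n - a)) * joint_distribution q1 q2 (n - a) k l)"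
proof -
  define G where "G m = {\<sigma> \<in> permutations_of_set {1..m}. occurrences q1 \<sigma> = k \<and> occurrences q2 \<sigma> = l}" for m
  define F where "F a \<sigma> = {\<pi> \<in> permutations_of_set {1..n}. hd \<pi> = a \<and> above_first \<pi> = \<sigma>}" for a \<sigma>
  have finG: "finite (G m)" and finF: "finite (F a \<sigma>)" for m a \<sigma>
    unfolding G_def F_def by simp_all
  have "{\<pi> \<in> permutations_of_set {1..n}. occurrences (prepend_min q1) \<pi> = k \<and>
      occurrences (prepend_min q2) \<pi> = l} = (\<Union>a \<in> {1..n}. \<Union>\<sigma> \<in> G (n - a). F a \<sigma>)" (is "?L = ?R")
  proof (intro equalityI subsetI)
    fix \<pi> assume "\<pi> \<in> ?L"
    then have \<pi>: "\<pi> \<in> permutations_of_set {1..n}" and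
      "occurrences (prepend_min q1) \<pi> = k" "occurrences (prepend_min q2) \<pi> = l" by simp_all
    then have "above_first \<pi> \<in> G (n - hd \<pi>)"
      using above_first_permutation[OF \<pi>] occurrences_prepend_min[OF \<pi> \<open>n > 0\<close>] q
      by (simp add: G_def)
    moreover have "hd \<pi> \<in> {1..n}"
      using permutations_of_setD(1)[OF \<pi>] length_permutation[OF \<pi>] \<open>n > 0\<close>
      by (metis hd_in_set length_0_conv less_irrefl)
    ultimately show "\<pi> \<in> ?R" using \<pi> by (auto simp: F_def)
  next
    fix \<pi> assume "\<pi> \<in> ?R"
    then have "\<pi> \<in> permutations_of_set {1..n}" "above_first \<pi> \<in> G (n - hd \<pi>)"
      by (auto simp: F_def)
    then show "\<pi> \<in> ?L"
      using occurrences_prepend_min[OF _ \<open>n > 0\<close>] q by (simp add: G_def)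
  qed
  then have "joint_distribution (prepend_min q1) (prepend_min q2) n k l = card ?R"
    by (simp only: joint_distribution_def)
  also have "\<dots> = (\<Sum>a = 1..n. card (\<Union>\<sigma> \<in> G (n - a). F a \<sigma>))"
    by (rule card_UN_disjoint) (use finG finF in \<open>auto simp: F_def\<close>)
  also have "\<dots> = (\<Sum>a = 1..n. \<Sum>\<sigma> \<in> G (n - a). card (F a \<sigma>))"
    by (intro sum.cong refl card_UN_disjoint) (use finG finF in \<open>auto simp: F_def\<close>)
  also have "\<dots> = (\<Sum>a = 1..n. fact (a - 1) * ((n - 1) choose (n - a)) * card (G (n - a)))"
  proof (rule sum.cong[OF refl])
    fix a assume a: "a \<in> {1..n}"
    have "card (F a \<sigma>) = fact (a - 1) * ((n - 1) choose (n - a))" if "\<sigma> \<in> G (n - a)" for \<sigma>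
      using card_above_first_fibre[OF a, of \<sigma>] that unfolding F_def G_def by blast
    then show "(\<Sum>\<sigma> \<in> G (n - a). card (F a \<sigma>)) =
        fact (a - 1) * ((n - 1) choose (n - a)) * card (G (n - a))" by simp
  qed
  finally show ?thesis by (simp only: G_def joint_distribution_def)
qed

text \<open>Size 0 is separate because the empty permutation has no first letter; the profile of a
  prolonged pattern is nonempty, so there is no occurrence.\<close>

lemma joint_distribution_prepend_min_0:
  assumes "is_mesh_pattern q1" "is_mesh_pattern q2"
  shows "joint_distribution (prepend_min q1) (prepend_min q2) 0 k l = of_bool (k = 0 \<and> l = 0)"
proof -
  have "occurrences (prepend_min q) [] = 0" if "is_mesh_pattern q" for q
  proof -
    have "occ_sets (prepend_min q) (points []) = {}"
      by (auto simp: occ_sets_def points_def profile_prepend_min[OF that])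
    then show ?thesis
      using occurrences_eq[of "[]" 0, OF _ is_mesh_pattern_prepend_min[OF that]] by simp
  qed
  then have "occurrences (prepend_min q1) [] = 0" "occurrences (prepend_min q2) [] = 0"
    using assms by blast+
  then have "{\<pi> \<in> permutations_of_set {1..0}. occurrences (prepend_min q1) \<pi> = k \<and>
      occurrences (prepend_min q2) \<pi> = l} = (if k = 0 \<and> l = 0 then {[]} else {})"
    by auto
  then show ?thesis unfolding joint_distribution_def by simp
qed

text \<open>Separate arguments \<open>k'\<close> and \<open>l'\<close> let this lift both equality
  of distributions and their symmetry in \<open>k\<close> and \<open>l\<close>; the last hypothesis
  settles \<open>n = 0\<close>.\<close>

lemma joint_distribution_prepend_min_cong:
  assumes "is_mesh_pattern q1" "is_mesh_pattern q2" "is_mesh_pattern q1'" "is_mesh_pattern q2'"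
    and "\<And>m. joint_distribution q1 q2 m k l = joint_distribution q1' q2' m k' l'"
    and "k = 0 \<and> l = 0 \<longleftrightarrow> k' = 0 \<and> l' = 0"
  shows "joint_distribution (prepend_min q1) (prepend_min q2) n k l =
         joint_distribution (prepend_min q1') (prepend_min q2') n k' l'"
  using assms by (cases "n = 0")
    (simp_all add: joint_distribution_prepend_min joint_distribution_prepend_min_0)

section \<open>Patterns of length two and the sixteen shadings\<close>

lemma is_mesh_pattern_length_2:
  "is_mesh_pattern ([1, 2], S) \<longleftrightarrow> S \<subseteq> {0..2} \<times> {0..2}"
  "is_mesh_pattern ([2, 1], S) \<longleftrightarrow> S \<subseteq> {0..2} \<times> {0..2}"
proof -
  have "{1..2} = {1, 2::nat}" by auto
  then have "[1, 2] \<in> permutations_of_set {1..2::nat}" "[2, 1] \<in> permutations_of_set {1..2::nat}"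
    by (auto simp: permutations_of_set_def)
  then show "is_mesh_pattern ([1, 2], S) \<longleftrightarrow> S \<subseteq> {0..2} \<times> {0..2}"
    "is_mesh_pattern ([2, 1], S) \<longleftrightarrow> S \<subseteq> {0..2} \<times> {0..2}"
    by (simp_all add: is_mesh_pattern_def Let_def numeral_2_eq_2)
qed

text \<open>Reversal exchanges the patterns 12 and 21, which is why \<open>k\<close> and
  \<open>l\<close> trade places.\<close>

lemma joint_distribution_length_2_flip:
  assumes "S \<subseteq> {0..2} \<times> {0..2}"
  shows "joint_distribution ([1, 2], flip 2 ` S) ([2, 1], flip 2 ` S) n k l =
         joint_distribution ([1, 2], S) ([2, 1], S) n l k"
proof -
  have "joint_distribution ([1, 2], flip 2 ` S) ([2, 1], flip 2 ` S) n k l =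
      joint_distribution ([2, 1], flip 2 ` S) ([1, 2], flip 2 ` S) n l k"
    by (rule joint_distribution_commute)
  also have "\<dots> = joint_distribution ([1, 2], S) ([2, 1], S) n l k"
  proof -
    have mesh: "is_mesh_pattern ([1, 2], S)" "is_mesh_pattern ([2, 1], S)"
      using assms is_mesh_pattern_length_2 by blast+
    show ?thesis
      using joint_distribution_rev[OF mesh, of n l k] by (simp add: numeral_2_eq_2)
  qed
  finally show ?thesis .
qed

lemma joint_distribution_length_2_converse:
  assumes "S \<subseteq> {0..2} \<times> {0..2}"
  shows "joint_distribution ([1, 2], S\<inverse>) ([2, 1], S\<inverse>) n k l =
         joint_distribution ([1, 2], S) ([2, 1], S) n k l"
proof (rule joint_distribution_converse)
  show "(profile [1, 2])\<inverse> = profile [1, 2]" "(profile [2, 1])\<inverse> = profile [2, 1]"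
    by (auto simp: profile_def lessThan_Suc)
qed (use assms is_mesh_pattern_length_2 in blast)+

definition lift_shading :: "(nat \<times> nat) set \<Rightarrow> (nat \<times> nat) set" where
  "lift_shading S = shadeC \<union> map_prod Suc Suc ` S"

lemma prepend_min_length_2:
  "prepend_min ([1, 2], S) = ([1, 2, 3], lift_shading S)"
  "prepend_min ([2, 1], S) = ([1, 3, 2], lift_shading S)"
proof -
  have "{0} \<times> {0..Suc 2} = shadeC"
    by (auto simp: shadeC_def)
  then show "prepend_min ([1, 2], S) = ([1, 2, 3], lift_shading S)"
    "prepend_min ([2, 1], S) = ([1, 3, 2], lift_shading S)"
    by (simp_all add: prepend_min_def lift_shading_def numeral_2_eq_2 numeral_3_eq_3)
qed


text \<open>For \<open>S\<close> inside the 3 by 3 grid with \<open>flip 2\<close> fixing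
  \<open>S\<inverse>\<close>, this family is closed under flipping and transposing.\<close>

definition orbit :: "(nat \<times> nat) set \<Rightarrow> (nat \<times> nat) set set" where
  "orbit S = {S, S\<inverse>, flip 2 ` S, (flip 2 ` S)\<inverse>}"

lemma joint_distribution_length_2_orbit:
  assumes S: "S \<subseteq> {0..2} \<times> {0..2}" and inv: "flip 2 ` S\<inverse> = S\<inverse>" and Q: "Q \<in> orbit S"
  shows "joint_distribution ([1, 2], Q) ([2, 1], Q) n k l = joint_distribution ([1, 2], S) ([2, 1], S) n k l"
    and "joint_distribution ([1, 2], S) ([2, 1], S) n k l = joint_distribution ([1, 2], S) ([2, 1], S) n l k"
proof -
  have S': "S\<inverse> \<subseteq> {0..2} \<times> {0..2}" "flip 2 ` S \<subseteq> {0..2} \<times> {0..2}"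
    using S by (auto simp: flip_def)
  note flip_S = joint_distribution_length_2_flip[OF S]
    and conv_S = joint_distribution_length_2_converse[OF S]
    and flip_conv_S = joint_distribution_length_2_flip[OF S'(1), unfolded inv]
    and conv_flip_S = joint_distribution_length_2_converse[OF S'(2)]
  \<comment> \<open>Flipping swaps \<open>k\<close> and \<open>l\<close> but fixes
    \<open>S\<inverse>\<close>, so the distribution for \<open>S\<inverse>\<close> is symmetric;
    transposition carries this over to \<open>S\<close>.\<close>
  show sym: "joint_distribution ([1, 2], S) ([2, 1], S) n k l = joint_distribution ([1, 2], S) ([2, 1], S) n l k"
    using flip_conv_S[of n k l] unfolding conv_S .
  show "joint_distribution ([1, 2], Q) ([2, 1], Q) n k l = joint_distribution ([1, 2], S) ([2, 1], S) n k l"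
    using Q sym conv_S[of n k l] flip_S[of n k l] conv_flip_S[of n k l] unfolding orbit_def by auto
qed

lemma joint_distribution_lift_orbit:
  assumes S: "S \<subseteq> {0..2} \<times> {0..2}" and inv: "flip 2 ` S\<inverse> = S\<inverse>" and Q: "Q \<in> orbit S"
  shows "joint_distribution ([1, 2, 3], lift_shading Q) ([1, 3, 2], lift_shading Q) n k l =
         joint_distribution ([1, 2, 3], lift_shading S) ([1, 3, 2], lift_shading S) n k l"
    and "joint_distribution ([1, 2, 3], lift_shading Q) ([1, 3, 2], lift_shading Q) n k l =
         joint_distribution ([1, 2, 3], lift_shading Q) ([1, 3, 2], lift_shading Q) n l k"
proof -
  have "Q \<subseteq> {0..2} \<times> {0..2}"
    using Q S by (auto simp: orbit_def flip_def)
  then have mesh: "is_mesh_pattern ([1, 2], S)" "is_mesh_pattern ([2, 1], S)"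
    "is_mesh_pattern ([1, 2], Q)" "is_mesh_pattern ([2, 1], Q)"
    using S is_mesh_pattern_length_2 by blast+
  note orb = joint_distribution_length_2_orbit[OF S inv Q]
  show "joint_distribution ([1, 2, 3], lift_shading Q) ([1, 3, 2], lift_shading Q) n k l =
      joint_distribution ([1, 2, 3], lift_shading S) ([1, 3, 2], lift_shading S) n k l"
    unfolding prepend_min_length_2[symmetric]
    by (rule joint_distribution_prepend_min_cong[OF mesh(3,4,1,2)]) (rule orb(1), rule refl)
  \<comment> \<open>Both orders of \<open>k\<close> and \<open>l\<close> are compared with the
    symmetric distribution for \<open>S\<close>.\<close>
  have "joint_distribution ([1, 2], Q) ([2, 1], Q) m k l = joint_distribution ([1, 2], Q) ([2, 1], Q) m l k" for m
    using orb(1)[of m k l] orb(1)[of m l k] orb(2)[of m k l] by simp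
  then show "joint_distribution ([1, 2, 3], lift_shading Q) ([1, 3, 2], lift_shading Q) n k l =
      joint_distribution ([1, 2, 3], lift_shading Q) ([1, 3, 2], lift_shading Q) n l k"
    unfolding prepend_min_length_2[symmetric]
    by (intro joint_distribution_prepend_min_cong[OF mesh(3,4,3,4)]) auto
qed

text \<open>The permutations 123 and 132 are their own inverses, so inversion carries the results
  for \<open>shadeX\<close> over to \<open>shadeY\<close>.\<close>

lemma joint_distribution_lift_converse:
  assumes "Q \<subseteq> {0..2} \<times> {0..2}"
  shows "joint_distribution ([1, 2, 3], (lift_shading Q)\<inverse>) ([1, 3, 2], (lift_shading Q)\<inverse>) n k l =
         joint_distribution ([1, 2, 3], lift_shading Q) ([1, 3, 2], lift_shading Q) n k l"
proof (rule joint_distribution_converse)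
  have "is_mesh_pattern ([1, 2], Q)" "is_mesh_pattern ([2, 1], Q)"
    using assms is_mesh_pattern_length_2 by blast+
  then show "is_mesh_pattern ([1, 2, 3], lift_shading Q)" "is_mesh_pattern ([1, 3, 2], lift_shading Q)"
    unfolding prepend_min_length_2[symmetric] using is_mesh_pattern_prepend_min by blast+
  show "(profile [1, 2, 3])\<inverse> = profile [1, 2, 3]" "(profile [1, 3, 2])\<inverse> = profile [1, 3, 2]"
    by (auto simp: profile_def lessThan_Suc)
qed

section \<open>The four blocks of shadings\<close>

lemma block_distributions:
  assumes S: "S \<subseteq> {0..2} \<times> {0..2}" and inv: "flip 2 ` S\<inverse> = S\<inverse>"
    and X: "\<forall>j \<in> J. shadeX j \<in> lift_shading ` orbit S"
    and ij: "i \<in> J" "j \<in> J"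
  shows "([1, 2, 3], shadeX j) \<sim>jd ([1, 3, 2], shadeX j)"
    and "([1, 2, 3], shadeY j) \<sim>jd ([1, 3, 2], shadeY j)"
    and "same_joint_distribution (([1, 2, 3], shadeX i), ([1, 3, 2], shadeX i))
           (([1, 2, 3], shadeX j), ([1, 3, 2], shadeX j))"
    and "same_joint_distribution (([1, 2, 3], shadeY i), ([1, 3, 2], shadeY i))
           (([1, 2, 3], shadeY j), ([1, 3, 2], shadeY j))"
proof -
  let ?D = "\<lambda>R. joint_distribution ([1, 2, 3], R) ([1, 3, 2], R)"
  have X_D: "?D (shadeX j) n k l = ?D (lift_shading S) n k l \<and> ?D (shadeX j) n k l = ?D (shadeX j) n l k"
    if j: "j \<in> J" for j n k l
  proof -
    obtain Q where Q: "Q \<in> orbit S" "shadeX j = lift_shading Q" using X j by blast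
    show ?thesis
      unfolding Q(2) using joint_distribution_lift_orbit[OF S inv Q(1)] by blast
  qed
  have Y_D: "?D (shadeY j) n k l = ?D (shadeX j) n k l" if j: "j \<in> J" for j n k l
  proof -
    obtain Q where Q: "Q \<in> orbit S" "shadeX j = lift_shading Q" using X j by blast
    have "Q \<subseteq> {0..2} \<times> {0..2}" using Q(1) S by (auto simp: orbit_def flip_def)
    moreover have "shadeY j = (shadeX j)\<inverse>" by (auto simp: shadeY_def)
    ultimately show ?thesis using joint_distribution_lift_converse Q(2) by simp
  qed
  show "([1, 2, 3], shadeX j) \<sim>jd ([1, 3, 2], shadeX j)" "([1, 2, 3], shadeY j) \<sim>jd ([1, 3, 2], shadeY j)"
    unfolding jointly_equidistributed_def using X_D Y_D ij by metis+
  show "same_joint_distribution (([1, 2, 3], shadeX i), ([1, 3, 2], shadeX i))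
      (([1, 2, 3], shadeX j), ([1, 3, 2], shadeX j))"
    "same_joint_distribution (([1, 2, 3], shadeY i), ([1, 3, 2], shadeY i))
      (([1, 2, 3], shadeY j), ([1, 3, 2], shadeY j))"
    unfolding same_joint_distribution_def fst_conv snd_conv using X_D Y_D ij by metis+
qed

text \<open>The representative must be invariant under exchanging rows 0 and 2, which is what the
  condition on \<open>S\<inverse>\<close> says; not every member of a block qualifies.\<close>

lemma shadeX_blocks:
  assumes "J \<in> {{1, 2, 3, 4}, {5, 6, 7, 8}, {9, 10, 11, 12}, {13, 14, 15, 16}}"
  obtains S where "S \<subseteq> {0..2} \<times> {0..2}" "flip 2 ` S\<inverse> = S\<inverse>"
    "\<forall>j \<in> J. shadeX j \<in> lift_shading ` orbit S"
proof -
  have conv: "(insert (a, b) A)\<inverse> = insert (b, a) (A\<inverse>)" for a b :: nat and A by auto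
  note defs = shadeX_def shadeS_def shadings_def lift_shading_def orbit_def flip_def conv
    numeral_2_eq_2 numeral_3_eq_3
  show thesis
    using assms
  proof (elim insertE emptyE)
    assume J: "J = {1, 2, 3, 4}"
    show ?thesis
    \<comment> \<open>This is \<open>shadeS 1\<close> shifted by \<open>(-1, -1)\<close>.\<close>
    proof (rule that[of "{(0,0), (0,1), (0,2), (1,1), (2,1)}"])
      show "\<forall>j \<in> J. shadeX j \<in> lift_shading ` orbit {(0,0), (0,1), (0,2), (1,1), (2,1)}"
        unfolding J by (intro ballI, elim insertE emptyE; simp add: defs insert_commute)
    qed (auto simp: conv flip_def)
  next
    assume J: "J = {5, 6, 7, 8}"
    show ?thesis
    \<comment> \<open>This is \<open>shadeS 7\<close> shifted; \<open>shadeS 5\<close> is symmetric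
      about the other axis and would fail the invariance.\<close>
    proof (rule that[of "{(0,0), (0,2), (1,0), (1,1), (1,2)}"])
      show "\<forall>j \<in> J. shadeX j \<in> lift_shading ` orbit {(0,0), (0,2), (1,0), (1,1), (1,2)}"
        unfolding J by (intro ballI, elim insertE emptyE; simp add: defs insert_commute)
    qed (auto simp: conv flip_def)
  next
    assume J: "J = {9, 10, 11, 12}"
    show ?thesis
    \<comment> \<open>Here \<open>shadeS 11\<close> shifted has the required symmetry.\<close>
    proof (rule that[of "{(0,0), (0,2), (1,0), (1,2)}"])
      show "\<forall>j \<in> J. shadeX j \<in> lift_shading ` orbit {(0,0), (0,2), (1,0), (1,2)}"
        unfolding J by (intro ballI, elim insertE emptyE; simp add: defs insert_commute)
    qed (auto simp: conv flip_def)
  next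
    assume J: "J = {13, 14, 15, 16}"
    show ?thesis
    \<comment> \<open>Here \<open>shadeS 13\<close> shifted has the required symmetry.\<close>
    proof (rule that[of "{(0,0), (0,1), (0,2), (2,1)}"])
      show "\<forall>j \<in> J. shadeX j \<in> lift_shading ` orbit {(0,0), (0,1), (0,2), (2,1)}"
        unfolding J by (intro ballI, elim insertE emptyE; simp add: defs insert_commute)
    qed (auto simp: conv flip_def)
  qed
qed

theorem mainTheorem1:
  shows "(\<forall>j \<in> {1..16}.
            ([1,2,3], shadeX j) \<sim>jd ([1,3,2], shadeX j) \<and>
            ([1,2,3], shadeY j) \<sim>jd ([1,3,2], shadeY j)) \<and>
         (\<forall>J \<in> {{1,2,3,4}, {5,6,7,8}, {9,10,11,12}, {13,14,15,16}}. \<forall>i \<in> J. \<forall>j \<in> J.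
            same_joint_distribution
              (([1,2,3], shadeX i), ([1,3,2], shadeX i)) (([1,2,3], shadeX j), ([1,3,2], shadeX j)) \<and>
            same_joint_distribution
              (([1,2,3], shadeY i), ([1,3,2], shadeY i)) (([1,2,3], shadeY j), ([1,3,2], shadeY j)))"
proof (intro conjI ballI)
  let ?blocks = "{{1,2,3,4}, {5,6,7,8}, {9,10,11,12}, {13,14,15,16 :: nat}}"
  {
    fix j :: nat assume "j \<in> {1..16}"
    then have "j \<in> {1..4} \<or> j \<in> {5..8} \<or> j \<in> {9..12} \<or> j \<in> {13..16}" by auto
    moreover have "{1..4} = {1, 2, 3, 4 :: nat}" "{5..8} = {5, 6, 7, 8 :: nat}"
      "{9..12} = {9, 10, 11, 12 :: nat}" "{13..16} = {13, 14, 15, 16 :: nat}" by auto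
    ultimately obtain J where "J \<in> ?blocks" and j: "j \<in> J" by blast
    from this(1) obtain S where S: "S \<subseteq> {0..2} \<times> {0..2}" "flip 2 ` S\<inverse> = S\<inverse>"
      "\<forall>j \<in> J. shadeX j \<in> lift_shading ` orbit S" by (rule shadeX_blocks)
    show "([1,2,3], shadeX j) \<sim>jd ([1,3,2], shadeX j)" "([1,2,3], shadeY j) \<sim>jd ([1,3,2], shadeY j)"
      \<comment> \<open>Joint equidistribution concerns a single index, so \<open>j\<close> fills
        both places.\<close>
      by (rule block_distributions[OF S j j])+
  next
    fix J i j assume "J \<in> ?blocks" and ij: "i \<in> J" "j \<in> J"
    from this(1) obtain S where S: "S \<subseteq> {0..2} \<times> {0..2}" "flip 2 ` S\<inverse> = S\<inverse>"
      "\<forall>j \<in> J. shadeX j \<in> lift_shading ` orbit S" by (rule shadeX_blocks)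
    show "same_joint_distribution
        (([1,2,3], shadeX i), ([1,3,2], shadeX i)) (([1,2,3], shadeX j), ([1,3,2], shadeX j))"
      "same_joint_distribution
        (([1,2,3], shadeY i), ([1,3,2], shadeY i)) (([1,2,3], shadeY j), ([1,3,2], shadeY j))"
      by (rule block_distributions[OF S ij])+
  }
qed

end
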